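(* Suppose the standing assumptions (A1)–(A3) of the context hold, $\{x_k\}$ is an infinite sequence generated by the SQP algorithm of the context, and MFCQ is satisfied at all accumulation points of $\{x_k\}$. Suppose the potential function $L$ is a KL function, the constraint functions $c_i$, $i\in\mathcal E\cup\mathcal I$, are twice continuously differentiable, and (for $k$ large enough) there is $c_b\in(0,1)$ such that $B_k$ and its corresponding constant $b$ satisfy $c_bb-\bar\theta c_h\ge0$. Let $2b\ge l+\sigma$ and $l/c_b>b\ge\sigma\ge\rho$. Suppose $L$ satisfies the KL property with exponent $\alpha\in[0,1)$. If $\alpha\in(0,\frac12]$, then there exist $q_0\in(0,1)$ and $q_1>0$ such that for all $k$ large enough $\|x_k-\bar x\|\le q_1q_0^k$, where $\bar x$ is the limit of $\{x_k\}$ ($x_k\to\bar x$).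
   Context: Problem: $\mathcal E,\mathcal I$ are finite disjoint index sets, $m=|\mathcal E|+|\mathcal I|$, $c_i:\mathbb{R}^n\to\mathbb{R}$ for $i\in\mathcal E\cup\mathcal I$, $f:\mathbb{R}^n\to\mathbb{R}\cup\{+\infty\}$. Minimize $f(x)$ subject to $c_i(x)=0$ ($i\in\mathcal E$), $c_i(x)\ge0$ ($i\in\mathcal I$); the feasible set is $\Omega$. Notation: $[y]^-=\max\{0,-y\}$, $v(x)=\sum_{i\in\mathcal E}|c_i(x)|+\sum_{i\in\mathcal I}[c_i(x)]^-$, merit function $\phi(x,\theta)=f(x)+\theta v(x)$; $\bar\partial f$ is the Clarke subdifferential; $\|\cdot\|$ is the Euclidean norm. $f$ is upper-$C^2$ on an open set $O$ if near each point of $O$ it can be written $f(x)=\min_{t\in T}f_t(x)$ with $T$ a compact space, each $f_t$ of class $C^2$, and $f_t$ and its partial derivatives in $x$ up to order 2 jointly continuous in $(t,x)$. SQP algorithm: given $x_0$, $\theta_0>0$, $\eta\in(0,1)$, $\tau_\alpha\in(0,1)$, $\gamma>0$ (stopping tolerances zero: it stops only if $d_k=0$ and $v(x_k)=0$). At iteration $k$: take any $g_k\in\bar\partial f(x_k)$ and a symmetric matrix $B_k$; let $(d_k,v^k,w^k,t^k)$ solve $$\min_{d,v,w,t} f(x_k)+g_k^Td+\tfrac12 d^TB_kd+\theta_k\sum_{i\in\mathcal E}(v_i+w_i)+\theta_k\sum_{i\in\mathcal I}t_i$$ s.t. $c_i(x_k)+\nabla c_i(x_k)^Td=v_i-w_i$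 ($i\in\mathcal E$), $c_i(x_k)+\nabla c_i(x_k)^Td\ge -t_i$ ($i\in\mathcal I$), $v,w,t\ge0$. $\Omega_k$ denotes the feasible region of this subproblem, written in the variables $x=x_k+d$ and $v,w,t$. Let $\lambda^{k+1}\in\mathbb{R}^m$ be the Lagrange multiplier of the linearized constraints, i.e. with some $p^{k+1},q^{k+1},r^{k+1}\ge0$: $g_k+B_kd_k-\sum_{i}\lambda_i^{k+1}\nabla c_i(x_k)=0$; $\lambda_i^{k+1}\ge0$ and $\lambda_i^{k+1}[c_i(x_k)+\nabla c_i(x_k)^Td_k+t_i^k]=0$ for $i\in\mathcal I$; $\theta_k+\lambda_i^{k+1}=p_i^{k+1}$, $\theta_k-\lambda_i^{k+1}=q_i^{k+1}$, $p_i^{k+1}v_i^k=q_i^{k+1}w_i^k=0$ for $i\in\mathcal E$; $\theta_k-\lambda_i^{k+1}=r_i^{k+1}$, $r_i^{k+1}t_i^k=0$ for $i\in\mathcal I$. Set $\theta_{k+1}=\max\{\theta_k,\|\lambda^{k+1}\|_\infty+\gamma\}$. Let $\alpha_k$ be the first of $1,\tau_\alpha,\tau_\alpha^2,\dots$ such that $\phi(x_k,\theta_k)-\phi(x_k+\alpha_kd_k,\theta_k)\ge\eta\alpha_k\tfrac12d_k^TB_kd_k$; set $x_{k+1}=x_k+\alpha_kd_k$. $\bar\theta$ denotes the eventual constant value of the penalty parameter: $\theta_k=\bar\theta$ for all $k$ large enough. Standing assumptions. (A1) $f$ is Lipschitz continuous and upper-$C^2$; $\rho>0$ is a constant such that $-f+\frac\rho2\|\cdot\|^2$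 is convex on $D$ and $f(x)-f(\bar x)-\langle g,x-\bar x\rangle\le\frac\rho2\|x-\bar x\|^2$ for all $x,\bar x\in D$, $g\in\bar\partial f(\bar x)$. (A2) Each $c_i$ is continuously differentiable with Lipschitz gradient, and $H\ge0$ satisfies $|c_i(x')-c_i(x)-\nabla c_i(x)^T(x'-x)|\le\frac H2\|x-x'\|^2$ for all feasible $x,x'$ and all $i$; $c_h:=mH$. (A3) $\Omega$ and $\Omega_k$ are bounded for all $k$, and $D\subset\mathbb{R}^n$ is a convex compact set with $\Omega\subseteq D$ and $\Omega_k\subseteq D$ for all $k$ (the latter for the $x$ component); the $B_k$ are bounded and positive definite, and for some $b>0$, $d^TB_kd\ge b\|d\|^2$ for all $k$ and $d\in\mathbb{R}^n$. MFCQ: for a feasible point $x$ let $\mathcal A(x)=\mathcal E\cup\{i\in\mathcal I: c_i(x)=0\}$. MFCQ holds at $x$ if $\nabla c_i(x)$, $i\in\mathcal E$, are linearly independent and there is $w\in\mathbb{R}^n$ with $\nabla c_i(x)^Tw>0$ for all $i\in\mathcal A(x)\cap\mathcal I$ and $\nabla c_i(x)^Tw=0$ for all $i\in\mathcal E$. Potential function: $\sigma>0$, $l>0$ are constants; $F(x)=-f(x)+\frac12\sigma\|x\|^2$ for $x\in D$ and $F(x)=+\infty$ otherwise, with $\sigma$ such that $F$ is convex; $F^*(u)=\sup_x\{\langle u,x\rangle-F(x)\}$. Let $\bar c_i(x,w)=c_i(w)+\nabla c_i(w)^T(x-w)$, $\bar C=\{(x,w):\bar c_i(x,w)=0\ (i\in\mathcal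 E),\ \bar c_i(x,w)\ge0\ (i\in\mathcal I)\}$, and $i_{\bar C}$ its indicator function ($0$ on $\bar C$, $+\infty$ elsewhere). For $(x,y,w)\in(\mathbb{R}^n)^3$, $L(x,y,w)=-y^Tx+F^*(y)+\tfrac12\sigma\|x\|^2+\tfrac12 l\|x-w\|^2+i_{\bar C}(x,w)$. KL: $\partial$ denotes the limiting (general) subdifferential, $\mathrm{dom}\,\partial h=\{x:\partial h(x)\ne\emptyset\}$. A function $h$ has the KL property at $\hat x\in\mathrm{dom}\,\partial h$ if there are $a\in(0,\infty]$, a neighborhood $U$ of $\hat x$ and a continuous concave $\varphi:[0,a)\to[0,\infty)$ with $\varphi(0)=0$, $\varphi\in C^1(0,a)$, $\varphi'>0$ on $(0,a)$, such that $\varphi'(h(x)-h(\hat x))\,\mathrm{dist}(0,\partial h(x))\ge1$ for all $x\in U$ with $h(\hat x)<h(x)<h(\hat x)+a$ (with $\mathrm{dist}(0,\emptyset)=+\infty$). $h$ is a KL function if this holds at each point of $\mathrm{dom}\,\partial h$, and it satisfies the KL property with exponent $\alpha\in[0,1)$ if moreover $\varphi$ can be taken of the form $\varphi(s)=a_0s^{1-\alpha}$, $a_0>0$.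
   Formalization: In (A3), Ω_k with its unbounded slacks has all of R^n as x component, so Ω_k bounded and Ω_k ⊆ D cannot hold; instead only the zero-slack part of Ω_k is required to be bounded and in D, together with x_k and x_k+d_k in D for all k. *)

theory Defs
  imports "HOL-Analysis.Analysis"
begin

section \<open>Smooth and nonsmooth calculus\<close>

definition grad :: "('a::euclidean_space \<Rightarrow> real) \<Rightarrow> 'a \<Rightarrow> 'a" where
  "grad h x = (THE D. GDERIV h x :> D)"

definition C1_fun :: "('a::euclidean_space \<Rightarrow> real) \<Rightarrow> bool" where
  "C1_fun h \<longleftrightarrow> (\<forall>x. h differentiable (at x)) \<and> continuous_on UNIV (grad h)"

definition C2_fun :: "((real^'n) \<Rightarrow> real) \<Rightarrow> bool" where
  "C2_fun h \<longleftrightarrow> C1_fun h \<and>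
     (\<exists>H :: real^'n \<Rightarrow> real^'n^'n.
        (\<forall>x. (grad h has_derivative (\<lambda>u. H x *v u)) (at x)) \<and> continuous_on UNIV H)"

text \<open>Clarke's generalized directional derivative
  \<open>limsup (f (y + t v) - f y) / t\<close> as \<open>y \<rightarrow> x\<close> and \<open>t \<down> 0\<close>; it is only used at points near
  which \<open>f\<close> is finite and Lipschitz.\<close>

definition clarke_dderiv :: "('a::euclidean_space \<Rightarrow> ereal) \<Rightarrow> 'a \<Rightarrow> 'a \<Rightarrow> ereal" where
  "clarke_dderiv f x u =
     Limsup (nhds x \<times>\<^sub>F at_right (0::real)) (\<lambda>(y, t). (f (y + t *\<^sub>R u) - f y) / ereal t)"

definition clarke_subdiff :: "('a::euclidean_space \<Rightarrow> ereal) \<Rightarrow> 'a \<Rightarrow> 'a set" where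
  "clarke_subdiff f x = {g. \<forall>u. ereal (g \<bullet> u) \<le> clarke_dderiv f x u}"

text \<open>The type argument is the carrier type of the compact parameter spaces \<open>T\<close>. It cannot be
  quantified inside a definition; theorems are polymorphic in it, so \<open>T\<close> is an arbitrary
  compact space.\<close>

definition upper_C2_on ::
    "'t itself \<Rightarrow> (real^'n) set \<Rightarrow> ((real^'n) \<Rightarrow> ereal) \<Rightarrow> bool" where
  "upper_C2_on ty S f \<longleftrightarrow> open S \<and>
     (\<forall>p\<in>S. \<exists>V (T :: 't topology) (ft :: 't \<Rightarrow> real^'n \<Rightarrow> real)
          (G :: 't \<Rightarrow> real^'n \<Rightarrow> real^'n) (H :: 't \<Rightarrow> real^'n \<Rightarrow> real^'n^'n).
        open V \<and> p \<in> V \<and> V \<subseteq> S \<and> compact_space T \<and>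
        (\<forall>x\<in>V. (\<exists>t\<in>topspace T. f x = ereal (ft t x)) \<and>
               (\<forall>t\<in>topspace T. f x \<le> ereal (ft t x))) \<and>
        (\<forall>t\<in>topspace T. \<forall>x\<in>V.
           (ft t has_derivative (\<lambda>u. G t x \<bullet> u)) (at x) \<and>
           (G t has_derivative (\<lambda>u. H t x *v u)) (at x)) \<and>
        continuous_map (prod_topology T (top_of_set V)) euclidean (\<lambda>(t, x). ft t x) \<and>
        continuous_map (prod_topology T (top_of_set V)) euclidean (\<lambda>(t, x). G t x) \<and>
        continuous_map (prod_topology T (top_of_set V)) euclidean (\<lambda>(t, x). H t x))"

text \<open>Regular (Frechet) subgradients: \<open>h y \<ge> h x + v \<bullet> (y - x) + o(norm (y - x))\<close>. Both
  subdifferentials are empty where \<open>h\<close> is not finite.\<close>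

definition regular_subdiff :: "('a::euclidean_space \<Rightarrow> ereal) \<Rightarrow> 'a \<Rightarrow> 'a set" where
  "regular_subdiff h x = {v. \<bar>h x\<bar> \<noteq> \<infinity> \<and>
     (\<forall>e>0. \<forall>\<^sub>F y in nhds x. h x + ereal (v \<bullet> (y - x) - e * norm (y - x)) \<le> h y)}"

definition limiting_subdiff :: "('a::euclidean_space \<Rightarrow> ereal) \<Rightarrow> 'a \<Rightarrow> 'a set" where
  "limiting_subdiff h x = {v. \<bar>h x\<bar> \<noteq> \<infinity> \<and>
     (\<exists>xs vs. xs \<longlonglongrightarrow> x \<and> (\<lambda>j. h (xs j)) \<longlonglongrightarrow> h x \<and>
        (\<forall>j::nat. vs j \<in> regular_subdiff h (xs j)) \<and> vs \<longlonglongrightarrow> v)}"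

section \<open>The Kurdyka-Lojasiewicz property\<close>

text \<open>\<open>dist(0, S)\<close>, with value \<open>\<infinity>\<close> for \<open>S = {}\<close> (unlike \<open>infdist\<close>).\<close>

definition edist0 :: "'a::euclidean_space set \<Rightarrow> ereal" where
  "edist0 S = (INF v\<in>S. ereal (norm v))"

text \<open>\<open>psi\<close> is an admissible concave function on \<open>[0, a)\<close>, where \<open>a\<close> may be \<open>\<infinity>\<close>.\<close>

definition desingularizing :: "ereal \<Rightarrow> (real \<Rightarrow> real) \<Rightarrow> bool" where
  "desingularizing a psi \<longleftrightarrow> 0 < a \<and>
     continuous_on {s. 0 \<le> s \<and> ereal s < a} psi \<and>
     concave_on {s. 0 \<le> s \<and> ereal s < a} psi \<and>
     (\<forall>s. 0 \<le> s \<and> ereal s < a \<longrightarrow> 0 \<le> psi s) \<and>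
     psi 0 = 0 \<and>
     (\<forall>s. 0 < s \<and> ereal s < a \<longrightarrow> psi differentiable (at s) \<and> 0 < deriv psi s) \<and>
     continuous_on {s. 0 < s \<and> ereal s < a} (deriv psi)"

definition KL_inequality ::
    "('a::euclidean_space \<Rightarrow> ereal) \<Rightarrow> 'a \<Rightarrow> 'a set \<Rightarrow> ereal \<Rightarrow> (real \<Rightarrow> real) \<Rightarrow> bool" where
  "KL_inequality h xh U a psi \<longleftrightarrow>
     (\<forall>x\<in>U. h xh < h x \<and> h x < h xh + a \<longrightarrow>
        1 \<le> ereal (deriv psi (real_of_ereal (h x - h xh))) * edist0 (limiting_subdiff h x))"

definition KL_function :: "('a::euclidean_space \<Rightarrow> ereal) \<Rightarrow> bool" where
  "KL_function h \<longleftrightarrow> (\<forall>xh. limiting_subdiff h xh \<noteq> {} \<longrightarrow>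
     (\<exists>a U psi. open U \<and> xh \<in> U \<and> desingularizing a psi \<and> KL_inequality h xh U a psi))"

definition KL_exponent :: "('a::euclidean_space \<Rightarrow> ereal) \<Rightarrow> real \<Rightarrow> bool" where
  "KL_exponent h \<alpha> \<longleftrightarrow> (\<forall>xh. limiting_subdiff h xh \<noteq> {} \<longrightarrow>
     (\<exists>a U a0. open U \<and> xh \<in> U \<and> 0 < a0 \<and>
        desingularizing a (\<lambda>s. a0 * s powr (1 - \<alpha>)) \<and>
        KL_inequality h xh U a (\<lambda>s. a0 * s powr (1 - \<alpha>))))"

section \<open>The constrained problem\<close>

definition feasible_set :: "'i set \<Rightarrow> 'i set \<Rightarrow> ('i \<Rightarrow> real^'n \<Rightarrow> real) \<Rightarrow> (real^'n) set" where
  "feasible_set E I c = {x. (\<forall>i\<in>E. c i x = 0) \<and> (\<forall>i\<in>I. 0 \<le> c i x)}"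

definition violation :: "'i set \<Rightarrow> 'i set \<Rightarrow> ('i \<Rightarrow> real^'n \<Rightarrow> real) \<Rightarrow> real^'n \<Rightarrow> real" where
  "violation E I c x = (\<Sum>i\<in>E. \<bar>c i x\<bar>) + (\<Sum>i\<in>I. max 0 (- c i x))"

definition merit :: "'i set \<Rightarrow> 'i set \<Rightarrow> (real^'n \<Rightarrow> ereal) \<Rightarrow> ('i \<Rightarrow> real^'n \<Rightarrow> real) \<Rightarrow>
    real^'n \<Rightarrow> real \<Rightarrow> ereal" where
  "merit E I f c x \<theta> = f x + ereal (\<theta> * violation E I c x)"

text \<open>Feasibility of \<open>x\<close> is not part of this condition.\<close>

definition MFCQ :: "'i set \<Rightarrow> 'i set \<Rightarrow> ('i \<Rightarrow> real^'n \<Rightarrow> real) \<Rightarrow> real^'n \<Rightarrow> bool" where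
  "MFCQ E I c x \<longleftrightarrow>
     inj_on (\<lambda>i. grad (c i) x) E \<and> independent ((\<lambda>i. grad (c i) x) ` E) \<and>
     (\<exists>w. (\<forall>i\<in>I. c i x = 0 \<longrightarrow> 0 < grad (c i) x \<bullet> w) \<and> (\<forall>i\<in>E. grad (c i) x \<bullet> w = 0))"

definition accumulation_point :: "(nat \<Rightarrow> 'a::topological_space) \<Rightarrow> 'a \<Rightarrow> bool" where
  "accumulation_point X p \<longleftrightarrow> (\<exists>r. strict_mono r \<and> (X \<circ> r) \<longlonglongrightarrow> p)"

section \<open>The SQP algorithm\<close>

text \<open>Slack variables and multipliers are functions on the whole index type; only their values on
  \<open>E\<close> (for \<open>v\<close>, \<open>w\<close>), on \<open>I\<close> (for \<open>t\<close>) and on \<open>E \<union> I\<close> (for multipliers) are ever used.\<close>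

definition subproblem_region :: "'i set \<Rightarrow> 'i set \<Rightarrow> ('i \<Rightarrow> real^'n \<Rightarrow> real) \<Rightarrow> real^'n \<Rightarrow>
    ((real^'n) \<times> ('i \<Rightarrow> real) \<times> ('i \<Rightarrow> real) \<times> ('i \<Rightarrow> real)) set" where
  "subproblem_region E I c xk = {(x, v, w, t).
     (\<forall>i\<in>E. c i xk + grad (c i) xk \<bullet> (x - xk) = v i - w i \<and> 0 \<le> v i \<and> 0 \<le> w i) \<and>
     (\<forall>i\<in>I. - t i \<le> c i xk + grad (c i) xk \<bullet> (x - xk) \<and> 0 \<le> t i)}"

definition subproblem_obj :: "'i set \<Rightarrow> 'i set \<Rightarrow> (real^'n \<Rightarrow> ereal) \<Rightarrow> real^'n \<Rightarrow> real^'n \<Rightarrow>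
    real^'n^'n \<Rightarrow> real \<Rightarrow> real^'n \<Rightarrow> ('i \<Rightarrow> real) \<Rightarrow> ('i \<Rightarrow> real) \<Rightarrow> ('i \<Rightarrow> real) \<Rightarrow> ereal" where
  "subproblem_obj E I f xk gk Bk \<theta> d v w t =
     f xk + ereal (gk \<bullet> d + 1/2 * (d \<bullet> (Bk *v d))
                   + \<theta> * (\<Sum>i\<in>E. v i + w i) + \<theta> * (\<Sum>i\<in>I. t i))"

definition subproblem_solution :: "'i set \<Rightarrow> 'i set \<Rightarrow> (real^'n \<Rightarrow> ereal) \<Rightarrow>
    ('i \<Rightarrow> real^'n \<Rightarrow> real) \<Rightarrow> real^'n \<Rightarrow> real^'n \<Rightarrow> real^'n^'n \<Rightarrow> real \<Rightarrow>
    real^'n \<Rightarrow> ('i \<Rightarrow> real) \<Rightarrow> ('i \<Rightarrow> real) \<Rightarrow> ('i \<Rightarrow> real) \<Rightarrow> bool" where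
  "subproblem_solution E I f c xk gk Bk \<theta> d v w t \<longleftrightarrow>
     (xk + d, v, w, t) \<in> subproblem_region E I c xk \<and>
     (\<forall>(x', v', w', t') \<in> subproblem_region E I c xk.
        subproblem_obj E I f xk gk Bk \<theta> d v w t
          \<le> subproblem_obj E I f xk gk Bk \<theta> (x' - xk) v' w' t')"

definition subproblem_multiplier :: "'i set \<Rightarrow> 'i set \<Rightarrow> ('i \<Rightarrow> real^'n \<Rightarrow> real) \<Rightarrow>
    real^'n \<Rightarrow> real^'n \<Rightarrow> real^'n^'n \<Rightarrow> real \<Rightarrow>
    real^'n \<Rightarrow> ('i \<Rightarrow> real) \<Rightarrow> ('i \<Rightarrow> real) \<Rightarrow> ('i \<Rightarrow> real) \<Rightarrow> ('i \<Rightarrow> real) \<Rightarrow> bool" where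
  "subproblem_multiplier E I c xk gk Bk \<theta> d v w t lam \<longleftrightarrow> (\<exists>p q r.
     (\<forall>i\<in>E. 0 \<le> p i \<and> 0 \<le> q i) \<and> (\<forall>i\<in>I. 0 \<le> r i) \<and>
     gk + Bk *v d - (\<Sum>i\<in>E \<union> I. lam i *\<^sub>R grad (c i) xk) = 0 \<and>
     (\<forall>i\<in>I. 0 \<le> lam i \<and> lam i * (c i xk + grad (c i) xk \<bullet> d + t i) = 0) \<and>
     (\<forall>i\<in>E. \<theta> + lam i = p i \<and> \<theta> - lam i = q i \<and> p i * v i = 0 \<and> q i * w i = 0) \<and>
     (\<forall>i\<in>I. \<theta> - lam i = r i \<and> r i * t i = 0))"

definition sup_norm_on :: "'i set \<Rightarrow> ('i \<Rightarrow> real) \<Rightarrow> real" where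
  "sup_norm_on J lam = Max (insert 0 ((\<lambda>i. \<bar>lam i\<bar>) ` J))"

definition sufficient_decrease :: "'i set \<Rightarrow> 'i set \<Rightarrow> (real^'n \<Rightarrow> ereal) \<Rightarrow>
    ('i \<Rightarrow> real^'n \<Rightarrow> real) \<Rightarrow> real \<Rightarrow> real^'n \<Rightarrow> real^'n^'n \<Rightarrow> real \<Rightarrow> real^'n \<Rightarrow> real \<Rightarrow> bool" where
  "sufficient_decrease E I f c \<eta> xk Bk \<theta> d a \<longleftrightarrow>
     ereal (\<eta> * a * (1/2) * (d \<bullet> (Bk *v d)))
       \<le> merit E I f c xk \<theta> - merit E I f c (xk + a *\<^sub>R d) \<theta>"

text \<open>An infinite run. The multiplier computed in iteration \<open>k\<close> is \<open>lam (Suc k)\<close>; the value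
  \<open>lam 0\<close> is irrelevant. The conjunct on \<open>d k\<close> and the violation says that the stopping test
  never succeeds.\<close>

definition sqp_run :: "'i set \<Rightarrow> 'i set \<Rightarrow> (real^'n \<Rightarrow> ereal) \<Rightarrow> ('i \<Rightarrow> real^'n \<Rightarrow> real) \<Rightarrow>
    real \<Rightarrow> real \<Rightarrow> real \<Rightarrow> (nat \<Rightarrow> real^'n) \<Rightarrow> (nat \<Rightarrow> real) \<Rightarrow> (nat \<Rightarrow> real^'n) \<Rightarrow>
    (nat \<Rightarrow> real^'n^'n) \<Rightarrow> (nat \<Rightarrow> real^'n) \<Rightarrow> (nat \<Rightarrow> 'i \<Rightarrow> real) \<Rightarrow> (nat \<Rightarrow> 'i \<Rightarrow> real) \<Rightarrow>
    (nat \<Rightarrow> 'i \<Rightarrow> real) \<Rightarrow> (nat \<Rightarrow> 'i \<Rightarrow> real) \<Rightarrow> (nat \<Rightarrow> real) \<Rightarrow> bool" where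
  "sqp_run E I f c \<eta> \<tau> \<gamma> x \<theta> g B d v w t lam a \<longleftrightarrow>
     0 < \<theta> 0 \<and> 0 < \<eta> \<and> \<eta> < 1 \<and> 0 < \<tau> \<and> \<tau> < 1 \<and> 0 < \<gamma> \<and>
     (\<forall>k. g k \<in> clarke_subdiff f (x k) \<and>
          transpose (B k) = B k \<and>
          subproblem_solution E I f c (x k) (g k) (B k) (\<theta> k) (d k) (v k) (w k) (t k) \<and>
          \<not> (d k = 0 \<and> violation E I c (x k) = 0) \<and>
          subproblem_multiplier E I c (x k) (g k) (B k) (\<theta> k) (d k) (v k) (w k) (t k)
            (lam (Suc k)) \<and>
          \<theta> (Suc k) = max (\<theta> k) (sup_norm_on (E \<union> I) (lam (Suc k)) + \<gamma>) \<and>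
          (\<exists>j. a k = \<tau> ^ j \<and> sufficient_decrease E I f c \<eta> (x k) (B k) (\<theta> k) (d k) (\<tau> ^ j) \<and>
               (\<forall>i<j. \<not> sufficient_decrease E I f c \<eta> (x k) (B k) (\<theta> k) (d k) (\<tau> ^ i))) \<and>
          x (Suc k) = x k + a k *\<^sub>R d k)"

section \<open>Standing assumptions\<close>

text \<open>The objective may take the value \<open>\<infinity>\<close>, so Lipschitz continuity and the upper-\<open>C\<^sup>2\<close> property
  are required on some open set \<open>S \<supseteq> D\<close>.\<close>

definition assumption_A1 :: "'t itself \<Rightarrow> (real^'n) set \<Rightarrow> (real^'n \<Rightarrow> ereal) \<Rightarrow> real \<Rightarrow> bool" where
  "assumption_A1 ty D f \<rho> \<longleftrightarrow>
     (\<exists>S. open S \<and> D \<subseteq> S \<and> (\<forall>x\<in>S. \<bar>f x\<bar> \<noteq> \<infinity>) \<and>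
          (\<exists>K. K-lipschitz_on S (\<lambda>x. real_of_ereal (f x))) \<and> upper_C2_on ty S f) \<and>
     0 < \<rho> \<and>
     convex_on D (\<lambda>x. - real_of_ereal (f x) + \<rho> / 2 * (norm x)\<^sup>2) \<and>
     (\<forall>x\<in>D. \<forall>y\<in>D. \<forall>g\<in>clarke_subdiff f y.
        real_of_ereal (f x) - real_of_ereal (f y) - g \<bullet> (x - y) \<le> \<rho> / 2 * (norm (x - y))\<^sup>2)"

definition assumption_A2 :: "'i set \<Rightarrow> 'i set \<Rightarrow> ('i \<Rightarrow> real^'n \<Rightarrow> real) \<Rightarrow> real \<Rightarrow> bool" where
  "assumption_A2 E I c H \<longleftrightarrow>
     (\<forall>i\<in>E \<union> I. C1_fun (c i) \<and> (\<exists>K. K-lipschitz_on UNIV (grad (c i)))) \<and>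
     0 \<le> H \<and>
     (\<forall>i\<in>E \<union> I. \<forall>x\<in>feasible_set E I c. \<forall>x'\<in>feasible_set E I c.
        \<bar>c i x' - c i x - grad (c i) x \<bullet> (x' - x)\<bar> \<le> H / 2 * (norm (x - x'))\<^sup>2)"

text \<open>Because the slack variables are unbounded, the region of the subproblem is never bounded and
  its projection to the \<open>x\<close> component is the whole space. Requiring that region to be bounded, or
  its projection to lie in the compact set \<open>D\<close>, would be contradictory.\<close>

lemma subproblem_region_x_component:
  "fst ` subproblem_region E I c xk = UNIV"
proof -
  have "(x, \<lambda>i. max 0 (c i xk + grad (c i) xk \<bullet> (x - xk)),
            \<lambda>i. max 0 (- (c i xk + grad (c i) xk \<bullet> (x - xk))),
            \<lambda>i. \<bar>c i xk + grad (c i) xk \<bullet> (x - xk)\<bar>) \<in> subproblem_region E I c xk" for x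
    by (auto simp: subproblem_region_def max_def abs_if)
  then show ?thesis
    by (force simp: image_iff)
qed

text \<open>Boundedness and inclusion in \<open>D\<close> are therefore imposed on the part of the region with
  vanishing slacks and on the two points \<open>x k\<close> and \<open>x k + d k\<close> at which the algorithm uses the
  region (both are \<open>x\<close> components of points of the region, the first one with direction \<open>0\<close>).\<close>

definition linearized_region :: "'i set \<Rightarrow> 'i set \<Rightarrow> ('i \<Rightarrow> real^'n \<Rightarrow> real) \<Rightarrow> real^'n \<Rightarrow>
    (real^'n) set" where
  "linearized_region E I c xk =
     {x. (x, (\<lambda>_. 0), (\<lambda>_. 0), (\<lambda>_. 0)) \<in> subproblem_region E I c xk}"

definition assumption_A3 :: "'i set \<Rightarrow> 'i set \<Rightarrow> ('i \<Rightarrow> real^'n \<Rightarrow> real) \<Rightarrow> (real^'n) set \<Rightarrow>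
    (nat \<Rightarrow> real^'n) \<Rightarrow> (nat \<Rightarrow> real^'n) \<Rightarrow> (nat \<Rightarrow> real^'n^'n) \<Rightarrow> real \<Rightarrow> bool" where
  "assumption_A3 E I c D x d B b \<longleftrightarrow>
     bounded (feasible_set E I c) \<and> (\<forall>k. bounded (linearized_region E I c (x k))) \<and>
     convex D \<and> compact D \<and> feasible_set E I c \<subseteq> D \<and>
     (\<forall>k. linearized_region E I c (x k) \<subseteq> D \<and> x k \<in> D \<and> x k + d k \<in> D) \<and>
     bounded (range B) \<and> (\<forall>k u. u \<noteq> 0 \<longrightarrow> 0 < u \<bullet> (B k *v u)) \<and>
     0 < b \<and> (\<forall>k u. b * (norm u)\<^sup>2 \<le> u \<bullet> (B k *v u))"

section \<open>The potential function\<close>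

definition pot_F :: "(real^'n \<Rightarrow> ereal) \<Rightarrow> (real^'n) set \<Rightarrow> real \<Rightarrow> real^'n \<Rightarrow> ereal" where
  "pot_F f D \<sigma> x = (if x \<in> D then - f x + ereal (\<sigma> / 2 * (norm x)\<^sup>2) else \<infinity>)"

definition conjugate :: "('a::euclidean_space \<Rightarrow> ereal) \<Rightarrow> 'a \<Rightarrow> ereal" where
  "conjugate F u = (SUP x. ereal (u \<bullet> x) - F x)"

definition lin_constraint :: "('i \<Rightarrow> real^'n \<Rightarrow> real) \<Rightarrow> 'i \<Rightarrow> real^'n \<Rightarrow> real^'n \<Rightarrow> real" where
  "lin_constraint c i x w = c i w + grad (c i) w \<bullet> (x - w)"

definition lin_constraint_set :: "'i set \<Rightarrow> 'i set \<Rightarrow> ('i \<Rightarrow> real^'n \<Rightarrow> real) \<Rightarrow>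
    ((real^'n) \<times> (real^'n)) set" where
  "lin_constraint_set E I c =
     {(x, w). (\<forall>i\<in>E. lin_constraint c i x w = 0) \<and> (\<forall>i\<in>I. 0 \<le> lin_constraint c i x w)}"

definition potential :: "'i set \<Rightarrow> 'i set \<Rightarrow> (real^'n \<Rightarrow> ereal) \<Rightarrow> ('i \<Rightarrow> real^'n \<Rightarrow> real) \<Rightarrow>
    (real^'n) set \<Rightarrow> real \<Rightarrow> real \<Rightarrow> (real^'n) \<times> (real^'n) \<times> (real^'n) \<Rightarrow> ereal" where
  "potential E I f c D \<sigma> l = (\<lambda>(x, y, w).
     ereal (- (y \<bullet> x)) + conjugate (pot_F f D \<sigma>) y
     + ereal (\<sigma> / 2 * (norm x)\<^sup>2) + ereal (l / 2 * (norm (x - w))\<^sup>2)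
     + (if (x, w) \<in> lin_constraint_set E I c then 0 else \<infinity>))"

end

theory Submission
  imports Defs
begin

text \<open>
  Once the penalty parameter is constant, it exceeds all multipliers by \<open>\<gamma>\<close>, so the slacks vanish
  and the steps solve the linearized constraints exactly. Then
  \<open>- g\<^sub>k \<bullet> d\<^sub>k + \<theta> v(x\<^sub>k) = d\<^sub>k \<bullet> B\<^sub>k d\<^sub>k + T\<^sub>k\<close> with
  \<open>T\<^sub>k = \<Sum>i. \<lambda>\<^sub>i c\<^sub>i(x\<^sub>k) + \<theta> v(x\<^sub>k) \<ge> 0\<close>. The line search has step sizes bounded below, and the merit
  function drops in each iteration by at least a multiple of \<open>\<parallel>d\<^sub>k\<parallel>\<^sup>2 + T\<^sub>k\<close>. Conversely, the potential
  function at \<open>(x\<^sub>k + d\<^sub>k, \<sigma> x\<^sub>k - g\<^sub>k, x\<^sub>k)\<close> equals \<open>f(x\<^sub>k) + g\<^sub>k \<bullet> d\<^sub>k + O(\<parallel>d\<^sub>k\<parallel>\<^sup>2)\<close> and has a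
  subgradient of norm \<open>O(\<parallel>d\<^sub>k\<parallel>)\<close> there, so the KL inequality with exponent at most \<open>1/2\<close> bounds the
  distance of the merit function to its limit by a multiple of \<open>\<parallel>d\<^sub>k\<parallel>\<^sup>2 + T\<^sub>k\<close>. Hence that distance
  contracts by a constant factor, also when step sizes below \<open>1\<close> are taken. The KL inequality is
  only local, but the potential is constant on the accumulation points of the bounded sequence above,
  which makes it uniform along the tail.
\<close>

section \<open>Subgradients, the KL inequality and linear rates\<close>

lemma GDERIV_grad:
  assumes "h differentiable (at x)"
  shows "GDERIV h x :> grad h x"
proof -
  obtain h' where h': "(h has_derivative h') (at x)"
    using assms by (auto simp: differentiable_def)
  interpret h': bounded_linear h' using h' by (rule has_derivative_bounded_linear)
  have "h' u = u \<bullet> (\<Sum>b\<in>Basis. h' b *\<^sub>R b)" for u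
  proof -
    have "h' u = h' (\<Sum>b\<in>Basis. (u \<bullet> b) *\<^sub>R b)" by (simp add: euclidean_representation)
    also have "\<dots> = (\<Sum>b\<in>Basis. (u \<bullet> b) *\<^sub>R h' b)" by (simp only: h'.sum h'.scale)
    finally show ?thesis by (simp add: inner_sum_right mult.commute)
  qed
  then have "h' = (\<lambda>u. u \<bullet> (\<Sum>b\<in>Basis. h' b *\<^sub>R b))" by blast
  with h' have D: "GDERIV h x :> (\<Sum>b\<in>Basis. h' b *\<^sub>R b)"
    unfolding gderiv_def by simp
  have "D' = D''" if "GDERIV h x :> D'" "GDERIV h x :> D''" for D' D''
  proof -
    have "(\<lambda>u. u \<bullet> D') = (\<lambda>u. u \<bullet> D'')"
      using that unfolding gderiv_def by (rule has_derivative_unique)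
    then show ?thesis by (metis vector_eq_ldot)
  qed
  with D show ?thesis
    unfolding grad_def by (rule_tac theI) blast+
qed

lemma has_derivative_grad:
  assumes "h differentiable (at x)"
  shows "(h has_derivative (\<lambda>u. grad h x \<bullet> u)) (at x)"
  using GDERIV_grad[OF assms] by (simp add: gderiv_def inner_commute)

text \<open>The mean value bound along the segment from \<open>x\<close> to \<open>x + u\<close>, on
  which the gradient varies by at most \<open>K * norm u\<close>. No feasibility enters, so the
  estimate applies at infeasible iterates and trial points. The sharper factor 1/2 is given up,
  since only the existence of some constant matters.\<close>

lemma Lipschitz_grad_linearization:
  assumes "C1_fun h" "K-lipschitz_on UNIV (grad h)"
  shows "\<bar>h (x + u) - h x - grad h x \<bullet> u\<bar> \<le> K * (norm u)\<^sup>2"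
proof -
  have K: "0 \<le> K" using assms(2) by (rule lipschitz_on_nonneg)
  have "norm (h (x + u) - h x - grad h x \<bullet> (x + u - x)) \<le> norm (x + u - x) * (K * norm u)"
  proof (rule differentiable_bound_linearization[where S = "closed_segment x (x + u)"
        and f' = "\<lambda>y s. grad h y \<bullet> s"])
    show "x + t *\<^sub>R (x + u - x) \<in> closed_segment x (x + u)" if "t \<in> {0..1}" for t
      using that by (auto simp: in_segment algebra_simps intro!: exI[of _ t])
    show "(h has_derivative (\<lambda>s. grad h y \<bullet> s)) (at y within closed_segment x (x + u))" for y
      using assms(1) has_derivative_grad has_derivative_at_withinI unfolding C1_fun_def by blast
    show "onorm ((\<lambda>s. grad h y \<bullet> s) - (\<lambda>s. grad h x \<bullet> s)) \<le> K * norm u"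
      if y: "y \<in> closed_segment x (x + u)" for y
    proof (rule onorm_le)
      fix s :: 'a
      have "norm (grad h y - grad h x) \<le> K * norm (y - x)"
        using lipschitz_onD[OF assms(2), of y x] by (simp add: dist_norm)
      also have "\<dots> \<le> K * norm u"
        using segment_bound1[OF y] K by (simp add: mult_left_mono norm_minus_commute)
      finally have "norm (grad h y - grad h x) * norm s \<le> K * norm u * norm s"
        by (simp add: mult_right_mono)
      then show "norm (((\<lambda>s. grad h y \<bullet> s) - (\<lambda>s. grad h x \<bullet> s)) s) \<le> K * norm u * norm s"
        using Cauchy_Schwarz_ineq2[of "grad h y - grad h x" s] by (simp add: inner_diff_left)
    qed
  qed simp
  then show ?thesis by (simp add: power2_eq_square mult_ac)
qed

section \<open>Regular and limiting subgradients\<close>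

lemma regular_subset_limiting_subdiff: "regular_subdiff h z \<subseteq> limiting_subdiff h z"
proof
  fix u assume u: "u \<in> regular_subdiff h z"
  then have "\<bar>h z\<bar> \<noteq> \<infinity>" by (simp add: regular_subdiff_def)
  moreover have "(\<lambda>_::nat. z) \<longlonglongrightarrow> z \<and> (\<lambda>_::nat. h z) \<longlonglongrightarrow> h z \<and>
      (\<forall>j::nat. u \<in> regular_subdiff h z) \<and> (\<lambda>_::nat. u) \<longlonglongrightarrow> u"
    using u by simp
  ultimately show "u \<in> limiting_subdiff h z"
    unfolding limiting_subdiff_def
    by (intro CollectI conjI exI[of _ "\<lambda>_. z"] exI[of _ "\<lambda>_. u"]) auto
qed

text \<open>Where a differentiable minorant touches \<open>h\<close>, its first-order expansion
  bounds \<open>h\<close> from below. Subgradients of the potential are obtained this way, without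
  sum rules for subdifferentials.\<close>

lemma smooth_minorant_regular_subdiff:
  assumes "(\<psi> has_derivative (\<lambda>u. p \<bullet> u)) (at z)"
    and "h z = ereal (\<psi> z)" and "\<And>y. ereal (\<psi> y) \<le> h y"
  shows "p \<in> regular_subdiff h z"
  unfolding regular_subdiff_def
proof (intro CollectI conjI allI impI)
  show "\<bar>h z\<bar> \<noteq> \<infinity>" using assms(2) by simp
  fix e :: real assume "0 < e"
  then obtain \<delta> where "0 < \<delta>"
    and \<delta>: "\<And>y. norm (y - z) < \<delta> \<Longrightarrow> norm (\<psi> y - \<psi> z - p \<bullet> (y - z)) \<le> e * norm (y - z)"
    using assms(1) unfolding has_derivative_at_alt by blast
  have "\<forall>\<^sub>F y in nhds z. dist y z < \<delta>"
    using \<open>0 < \<delta>\<close> by (auto simp: eventually_nhds_metric)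
  then show "\<forall>\<^sub>F y in nhds z. h z + ereal (p \<bullet> (y - z) - e * norm (y - z)) \<le> h y"
  proof eventually_elim
    case (elim y)
    have "\<psi> z + (p \<bullet> (y - z) - e * norm (y - z)) \<le> \<psi> y"
      using \<delta>[of y] elim by (auto simp: dist_norm)
    then show ?case
      using assms(3)[of y] assms(2) by (metis ereal_less_eq(3) order_trans plus_ereal.simps(1))
  qed
qed

text \<open>For values close to \<open>hs\<close> an exponent below \<open>1/2\<close> may be replaced by \<open>1/2\<close>, whose inequality
  reads \<open>sqrt (h - hs) \<le> C * dist 0 (\<partial>h)\<close>.\<close>

lemma KL_exponent_quadratic_near:
  assumes KL: "KL_inequality h p U A (\<lambda>s. a0 * s powr (1 - \<alpha>))"
    and "0 < a0" "0 < \<alpha>" "\<alpha> \<le> 1/2" "h p = ereal hs"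
    and "y \<in> U" "h y = ereal r" "ereal r < ereal hs + A" "r \<le> hs + 1"
    and s: "\<xi> \<in> limiting_subdiff h y"
  shows "r - hs \<le> (a0 * (1 - \<alpha>))\<^sup>2 * (norm \<xi>)\<^sup>2"
proof (cases "hs < r")
  case True
  define s where "s = r - hs"
  have s: "0 < s" "s \<le> 1" using True assms(9) by (auto simp: s_def)
  have "((\<lambda>s. a0 * s powr (1 - \<alpha>)) has_real_derivative a0 * ((1 - \<alpha>) * s powr (- \<alpha>))) (at s)"
    using s(1) by (auto intro!: derivative_eq_intros)
  then have der: "deriv (\<lambda>s. a0 * s powr (1 - \<alpha>)) s = a0 * (1 - \<alpha>) * s powr (- \<alpha>)"
    by (simp add: DERIV_imp_deriv)
  have "1 \<le> ereal (deriv (\<lambda>s. a0 * s powr (1 - \<alpha>)) s) * edist0 (limiting_subdiff h y)"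
    using KL assms True unfolding KL_inequality_def s_def by fastforce
  also have "\<dots> \<le> ereal (a0 * (1 - \<alpha>) * s powr (- \<alpha>)) * ereal (norm \<xi>)"
    unfolding der edist0_def
    using assms by (intro ereal_mult_left_mono INF_lower) auto
  finally have "1 \<le> a0 * (1 - \<alpha>) * s powr (- \<alpha>) * norm \<xi>"
    by (simp add: one_ereal_def)
  then have "s powr \<alpha> \<le> a0 * (1 - \<alpha>) * norm \<xi>"
    using s by (simp add: powr_minus field_simps)
  \<comment> \<open>For \<open>s\<close> in (0,1], a smaller exponent gives a larger power; this is
    where \<alpha> \<le> 1/2 enters, and why values at most \<open>hs + 1\<close> are
    considered.\<close>
  moreover have "sqrt s \<le> s powr \<alpha>"
    using s assms(4) by (simp add: powr_half_sqrt[symmetric] powr_mono')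
  ultimately have "sqrt s \<le> a0 * (1 - \<alpha>) * norm \<xi>" by linarith
  then have "(sqrt s)\<^sup>2 \<le> (a0 * (1 - \<alpha>) * norm \<xi>)\<^sup>2"
    using s by (intro power_mono) auto
  then show ?thesis using s by (simp add: s_def power_mult_distrib)
next
  case False
  then have "r - hs \<le> 0" by simp
  also have "0 \<le> (a0 * (1 - \<alpha>))\<^sup>2 * (norm \<xi>)\<^sup>2" by simp
  finally show ?thesis .
qed

text \<open>The constant \<open>C = n\<close> fails at arbitrarily late indices for every
  \<open>n\<close>, so the violating indices can be chosen increasing.\<close>

lemma not_eventually_bounded_subseq:
  assumes "\<nexists>C::real. \<forall>\<^sub>F k in sequentially. F k \<le> C * G k"
  obtains r :: "nat \<Rightarrow> nat" where "strict_mono r" "\<And>n. real n * G (r n) < F (r n)"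
proof -
  have ex: "\<exists>k>N. real n * G k < F k" for n N
  proof (rule ccontr)
    assume "\<not> ?thesis"
    then have "\<forall>k\<ge>Suc N. F k \<le> real n * G k" using Suc_le_lessD linorder_not_less by blast
    then show False using assms eventually_sequentially by blast
  qed
  obtain r where "\<And>n. real n * G (r n) < F (r n)" "\<And>n. r n < r (Suc n)"
    using dependent_nat_choice[of "\<lambda>n k. real n * G k < F k" "\<lambda>n k k'. k < k'"] ex by metis
  then show ?thesis using that strict_mono_Suc_iff by blast
qed

text \<open>The constant of the KL inequality depends on the base point. If no single constant
  served the tail, indices with ratios beyond every \<open>n\<close> would exist; by boundedness
  some of the points \<open>z\<close> there converge to an accumulation point \<open>p\<close>, and
  the one finite constant valid near \<open>p\<close> contradicts the growth.\<close>

lemma KL_exponent_quadratic_bound: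
  fixes z \<xi> :: "nat \<Rightarrow> 'a::euclidean_space"
  assumes KL: "KL_exponent h \<alpha>" and \<alpha>: "0 < \<alpha>" "\<alpha> \<le> 1/2"
    and bdd: "bounded (range z)"
    and fin: "\<And>k. h (z k) = ereal (r k)" and lim: "r \<longlonglongrightarrow> hs"
    and sub: "\<And>k. \<xi> k \<in> regular_subdiff h (z k)" and \<xi>: "\<xi> \<longlonglongrightarrow> 0"
    and acc: "\<And>p. accumulation_point z p \<Longrightarrow> h p = ereal hs"
  shows "\<exists>C. \<forall>\<^sub>F k in sequentially. r k - hs \<le> C * (norm (\<xi> k))\<^sup>2"
proof (rule ccontr)
  assume "\<not> ?thesis"
  then obtain q where q: "strict_mono q" "\<And>n. real n * (norm (\<xi> (q n)))\<^sup>2 < r (q n) - hs"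
    by (rule not_eventually_bounded_subseq[of "\<lambda>k. r k - hs" "\<lambda>k. (norm (\<xi> k))\<^sup>2"]) blast
  obtain p s where s: "strict_mono s" and "(\<lambda>n. (z \<circ> q) (s n)) \<longlonglongrightarrow> p"
    using bounded_imp_convergent_subsequence[of "z \<circ> q"] bounded_subset[OF bdd, of "range (z \<circ> q)"]
    by (auto simp: o_def)
  define m where "m = q \<circ> s"
  have m: "strict_mono m" unfolding m_def using q(1) s by (rule strict_mono_o)
  have zm: "(\<lambda>n. z (m n)) \<longlonglongrightarrow> p"
    using \<open>_ \<longlonglongrightarrow> p\<close> by (simp add: m_def)
  have hp: "h p = ereal hs"
    using acc m zm unfolding accumulation_point_def by (auto simp: o_def)
  have rm: "(\<lambda>n. r (m n)) \<longlonglongrightarrow> hs" and \<xi>m: "(\<lambda>n. \<xi> (m n)) \<longlonglongrightarrow> 0"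
    using LIMSEQ_subseq_LIMSEQ[OF lim m] LIMSEQ_subseq_LIMSEQ[OF \<xi> m] by (auto simp: o_def)
  \<comment> \<open>\<open>KL_exponent\<close> speaks only of points with a nonempty limiting
    subdifferential; 0 is such a subgradient at \<open>p\<close> because the \<open>\<xi>\<close>
    tend to 0 and the values converge to \<open>h p\<close>.\<close>
  have "0 \<in> limiting_subdiff h p"
    unfolding limiting_subdiff_def mem_Collect_eq
    by (intro conjI exI[of _ "\<lambda>n. z (m n)"] exI[of _ "\<lambda>n. \<xi> (m n)"])
       (simp_all add: zm rm \<xi>m sub fin hp)
  then obtain A U a0 where U: "open U" "p \<in> U" and a0: "0 < a0"
    and des: "desingularizing A (\<lambda>s. a0 * s powr (1 - \<alpha>))"
    and KLp: "KL_inequality h p U A (\<lambda>s. a0 * s powr (1 - \<alpha>))"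
    using KL unfolding KL_exponent_def by blast
  have "0 < A" using des unfolding desingularizing_def by blast
  then have "ereal hs < ereal hs + A" by (cases A) auto
  moreover have "(\<lambda>n. ereal (r (m n))) \<longlonglongrightarrow> ereal hs" using rm by simp
  ultimately have "\<forall>\<^sub>F n in sequentially. ereal (r (m n)) < ereal hs + A"
    by (rule order_tendstoD(2)[rotated])
  moreover have "\<forall>\<^sub>F n in sequentially. r (m n) < hs + 1"
    using rm by (rule order_tendstoD(2)) simp
  moreover have "\<forall>\<^sub>F n in sequentially. z (m n) \<in> U"
    using zm U by (rule topological_tendstoD)
  moreover have "\<forall>\<^sub>F n in sequentially. (a0 * (1 - \<alpha>))\<^sup>2 \<le> real n"
    by (rule eventually_sequentiallyI[of "nat \<lceil>(a0 * (1 - \<alpha>))\<^sup>2\<rceil>"]) linarith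
  ultimately have "\<forall>\<^sub>F n in sequentially. False"
  proof eventually_elim
    case (elim n)
    have "r (m n) - hs \<le> (a0 * (1 - \<alpha>))\<^sup>2 * (norm (\<xi> (m n)))\<^sup>2"
      using KL_exponent_quadratic_near[OF KLp a0 \<alpha> hp, of "z (m n)" "r (m n)" "\<xi> (m n)"]
        elim fin sub[of "m n"] regular_subset_limiting_subdiff by (meson less_imp_le subsetD)
    also have "\<dots> \<le> real n * (norm (\<xi> (m n)))\<^sup>2"
      using elim by (intro mult_right_mono) auto
    \<comment> \<open>Passing to the subsequence only strengthens the ratio, as \<open>n\<close> is
      at most \<open>s n\<close>.\<close>
    also have "\<dots> \<le> real (s n) * (norm (\<xi> (m n)))\<^sup>2"
      using seq_suble[OF s] by (intro mult_right_mono) auto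
    also have "\<dots> < r (m n) - hs" using q(2)[of "s n"] by (simp add: m_def)
    finally show False by simp
  qed
  then show False by simp
qed

text \<open>Squared increments are dominated by a geometrically decaying quantity, so the increments
  themselves decay with ratio \<open>sqrt q\<close>; their sum converges, and the tail of the
  geometric series bounds the distance to the limit.\<close>

lemma linear_rate:
  fixes x :: "nat \<Rightarrow> 'a::euclidean_space"
  assumes q: "0 < q" "q < 1" and C: "0 < C"
    and \<Delta>: "\<And>k. k \<ge> N \<Longrightarrow> \<Delta> (Suc k) \<le> q * \<Delta> k"
    and x: "\<And>k. k \<ge> N \<Longrightarrow> C * (norm (x (Suc k) - x k))\<^sup>2 \<le> \<Delta> k"
  shows "\<exists>xbar. x \<longlonglongrightarrow> xbar \<and>
           (\<exists>q\<^sub>0 q\<^sub>1. 0 < q\<^sub>0 \<and> q\<^sub>0 < 1 \<and> 0 < q\<^sub>1 \<and>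
              (\<forall>\<^sub>F k in sequentially. norm (x k - xbar) \<le> q\<^sub>1 * q\<^sub>0 ^ k))"
proof -
  define q0 where "q0 = sqrt q"
  have q0: "0 < q0" "q0 < 1" "q0\<^sup>2 = q" using q by (auto simp: q0_def)
  have \<Delta>0: "0 \<le> \<Delta> N" using order_trans[OF _ x[of N]] C by simp
  define P where "P = sqrt (\<Delta> N / C)"
  have P: "0 \<le> P" "P\<^sup>2 = \<Delta> N / C" using \<Delta>0 C by (auto simp: P_def)
  have \<Delta>k: "\<Delta> (N + j) \<le> q ^ j * \<Delta> N" for j
  proof (induction j)
    case (Suc j)
    have "\<Delta> (N + Suc j) \<le> q * \<Delta> (N + j)" using \<Delta>[of "N + j"] by simp
    also have "\<dots> \<le> q * (q ^ j * \<Delta> N)" using Suc q by (intro mult_left_mono) auto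
    finally show ?case by (simp add: mult_ac)
  qed simp
  define X where "X j = x (N + j)" for j
  have step: "norm (X (Suc j) - X j) \<le> P * q0 ^ j" for j
  proof (rule power2_le_imp_le)
    have "C * (norm (X (Suc j) - X j))\<^sup>2 \<le> q ^ j * \<Delta> N"
      using x[of "N + j"] \<Delta>k[of j] by (simp add: X_def)
    moreover have "(q0 ^ j)\<^sup>2 = q ^ j"
      by (metis q0(3) power_mult mult.commute)
    ultimately show "(norm (X (Suc j) - X j))\<^sup>2 \<le> (P * q0 ^ j)\<^sup>2"
      using C by (simp add: power_mult_distrib P(2) field_simps)
  qed (use P q0 in auto)
  have gs: "(\<lambda>j. P * q0 ^ (j + k)) sums (P * q0 ^ k / (1 - q0))" for k
    using sums_mult[OF geometric_sums[of q0], of "P * q0 ^ k"] q0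
    by (simp add: power_add mult_ac)
  have sm: "summable (\<lambda>j. norm (X (Suc j) - X j))"
    by (rule summable_comparison_test'[where N = 0, OF sums_summable[OF gs[of 0]]])
       (use step in auto)
  have "(\<lambda>n. X n - X 0) \<longlonglongrightarrow> (\<Sum>j. X (Suc j) - X j)"
    using summable_LIMSEQ[OF summable_norm_cancel[OF sm]] by (simp add: sum_lessThan_telescope)
  from tendsto_add[OF this tendsto_const[of "X 0"]]
  obtain xbar where xb: "X \<longlonglongrightarrow> xbar" by auto
  have tail: "norm (X k - xbar) \<le> P * q0 ^ k / (1 - q0)" for k
  proof -
    have X': "(\<lambda>j. X (j + k)) \<longlonglongrightarrow> xbar" using xb by (rule LIMSEQ_ignore_initial_segment)
    have "(\<lambda>j. X (Suc j + k) - X (j + k)) sums (xbar - X (0 + k))"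
      by (rule telescope_sums[OF X'])
    then have "xbar - X k = (\<Sum>j. X (Suc j + k) - X (j + k))" by (simp add: sums_iff)
    also have "norm \<dots> \<le> (\<Sum>j. P * q0 ^ (j + k))"
      by (rule norm_suminf_le) (use step sums_summable[OF gs[of k]] in auto)
    finally have "norm (xbar - X k) \<le> (\<Sum>j. P * q0 ^ (j + k))" .
    then show ?thesis using gs[of k] by (simp add: sums_iff norm_minus_commute)
  qed
  have "x \<longlonglongrightarrow> xbar"
    using xb unfolding X_def by (subst (asm) add.commute) (rule LIMSEQ_offset)
  \<comment> \<open>\<open>P + 1\<close> replaces \<open>P\<close> so that the factor is positive
    even when \<open>\<Delta> N = 0\<close>; dividing by \<open>q0 ^ N\<close> undoes the index
    shift.\<close>
  moreover have "norm (x k - xbar) \<le> ((P + 1) / (1 - q0) / q0 ^ N) * q0 ^ k" if "k \<ge> N" for k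
  proof -
    have "norm (x k - xbar) \<le> P * q0 ^ (k - N) / (1 - q0)"
      using tail[of "k - N"] that by (simp add: X_def)
    also have "\<dots> \<le> (P + 1) * q0 ^ (k - N) / (1 - q0)"
      using q0 by (intro divide_right_mono mult_right_mono) auto
    also have "\<dots> = ((P + 1) / (1 - q0) / q0 ^ N) * q0 ^ k"
      using q0 that by (simp add: power_diff)
    finally show ?thesis .
  qed
  moreover have "0 < (P + 1) / (1 - q0) / q0 ^ N" using P q0 by auto
  ultimately show ?thesis using q0(1,2)
    by (intro exI[of _ xbar] exI[of _ q0] exI[of _ "(P + 1) / (1 - q0) / q0 ^ N"] conjI
        eventually_sequentiallyI[of N])
qed

section \<open>A single step\<close>

text \<open>The optimality system of the subproblem once all slack variables vanish.\<close>

definition reduced_KKT :: "'i set \<Rightarrow> 'i set \<Rightarrow> ('i \<Rightarrow> real^'n \<Rightarrow> real) \<Rightarrow> real^'n \<Rightarrow> real^'n \<Rightarrow>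
    real^'n^'n \<Rightarrow> real^'n \<Rightarrow> ('i \<Rightarrow> real) \<Rightarrow> real \<Rightarrow> bool" where
  "reduced_KKT E I c x g B d lam \<theta> \<longleftrightarrow>
     g + B *v d = (\<Sum>i\<in>E \<union> I. lam i *\<^sub>R grad (c i) x) \<and>
     (\<forall>i\<in>E. c i x + grad (c i) x \<bullet> d = 0) \<and>
     (\<forall>i\<in>I. 0 \<le> c i x + grad (c i) x \<bullet> d \<and> 0 \<le> lam i) \<and>
     (\<forall>i\<in>E \<union> I. lam i * (c i x + grad (c i) x \<bullet> d) = 0 \<and> \<bar>lam i\<bar> \<le> \<theta>)"

text \<open>This is the merit function minus the Lagrangian
  \<open>f - (\<Sum>i. lam i * c i)\<close>, that is, the excess of the exact penalty over the
  multiplier term.\<close>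

definition multiplier_gap :: "'i set \<Rightarrow> 'i set \<Rightarrow> ('i \<Rightarrow> real^'n \<Rightarrow> real) \<Rightarrow> real^'n \<Rightarrow>
    ('i \<Rightarrow> real) \<Rightarrow> real \<Rightarrow> real" where
  "multiplier_gap E I c x lam \<theta> = (\<Sum>i\<in>E \<union> I. lam i * c i x) + \<theta> * violation E I c x"

lemma violation_nonneg: "0 \<le> violation E I c x"
  unfolding violation_def by (simp add: sum_nonneg add_nonneg_nonneg)

text \<open>An unchanged penalty means that the maximum in the update is attained by
  \<open>\<theta> k\<close>, which therefore exceeds every \<open>\<bar>lam (Suc k) i\<bar>\<close>
  by at least \<open>\<gamma>\<close>.\<close>

lemma sqp_run_reduced_KKT:
  assumes "finite E" "finite I"
    and run: "sqp_run E I f c \<eta> \<tau> \<gamma> x \<theta> g B d v w t lam a"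
    and th: "\<theta> (Suc k) = \<theta> k"
  shows "reduced_KKT E I c (x k) (g k) (B k) (d k) (lam (Suc k)) (\<theta> k)"
proof -
  have \<gamma>: "0 < \<gamma>" using run by (simp add: sqp_run_def)
  have sol: "(x k + d k, v k, w k, t k) \<in> subproblem_region E I c (x k)"
    using run by (simp add: sqp_run_def subproblem_solution_def)
  obtain p q r where
    m: "g k + B k *v d k - (\<Sum>i\<in>E \<union> I. lam (Suc k) i *\<^sub>R grad (c i) (x k)) = 0"
      "\<forall>i\<in>I. 0 \<le> lam (Suc k) i \<and>
         lam (Suc k) i * (c i (x k) + grad (c i) (x k) \<bullet> d k + t k i) = 0"
      "\<forall>i\<in>E. \<theta> k + lam (Suc k) i = p i \<and> \<theta> k - lam (Suc k) i = q i \<and>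
         p i * v k i = 0 \<and> q i * w k i = 0"
      "\<forall>i\<in>I. \<theta> k - lam (Suc k) i = r i \<and> r i * t k i = 0"
    using run unfolding sqp_run_def subproblem_multiplier_def by blast
  have "sup_norm_on (E \<union> I) (lam (Suc k)) + \<gamma> \<le> \<theta> k"
    using run th unfolding sqp_run_def by (metis max.cobounded2)
  moreover have "\<bar>lam (Suc k) i\<bar> \<le> sup_norm_on (E \<union> I) (lam (Suc k))" if "i \<in> E \<union> I" for i
    unfolding sup_norm_on_def using assms(1,2) that by (intro Max_ge) auto
  ultimately have lam: "\<bar>lam (Suc k) i\<bar> + \<gamma> \<le> \<theta> k" if "i \<in> E \<union> I" for i
    using that by fastforce
  \<comment> \<open>The slack multipliers \<theta> + \<lambda> and \<theta> - \<lambda> are at least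
    \<gamma>, hence positive, so complementarity annihilates the slacks.\<close>
  have E: "v k i = 0" "w k i = 0" if "i \<in> E" for i
    using m(3) lam[of i] \<gamma> that by (smt (verit) UnI1 mult_eq_0_iff)+
  have I: "t k i = 0" if "i \<in> I" for i
    using m(4) lam[of i] \<gamma> that by (smt (verit) UnI2 mult_eq_0_iff)
  show ?thesis
    unfolding reduced_KKT_def
  proof (intro conjI ballI)
    show "g k + B k *v d k = (\<Sum>i\<in>E \<union> I. lam (Suc k) i *\<^sub>R grad (c i) (x k))"
      using m(1) by simp
    show "\<bar>lam (Suc k) i\<bar> \<le> \<theta> k" if "i \<in> E \<union> I" for i
      using lam[OF that] \<gamma> by linarith
    show cE: "c i (x k) + grad (c i) (x k) \<bullet> d k = 0" if "i \<in> E" for i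
      using sol E that by (simp add: subproblem_region_def)
    show "0 \<le> c i (x k) + grad (c i) (x k) \<bullet> d k" "0 \<le> lam (Suc k) i" if "i \<in> I" for i
      using sol I m(2) that by (force simp: subproblem_region_def)+
    show "lam (Suc k) i * (c i (x k) + grad (c i) (x k) \<bullet> d k) = 0" if "i \<in> E \<union> I" for i
      using that cE m(2) I by force
  qed
qed

section \<open>Consequences of the optimality system at a single iterate\<close>

context
  fixes E I :: "'i set" and c :: "'i \<Rightarrow> real^'n \<Rightarrow> real" and x g d :: "real^'n"
    and B :: "real^'n^'n" and lam :: "'i \<Rightarrow> real" and \<theta> :: real
  assumes fin: "finite E" "finite I" "E \<inter> I = {}"
    and KKT: "reduced_KKT E I c x g B d lam \<theta>" and \<theta>: "0 \<le> \<theta>"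
begin

text \<open>The sum is nonnegative term by term: \<theta> dominates the absolute values of the
  multipliers, and for a satisfied inequality constraint the multiplier and the constraint value are
  both nonnegative.\<close>

lemma multiplier_gap_nonneg: "0 \<le> multiplier_gap E I c x lam \<theta>"
proof -
  have "0 \<le> lam i * c i x + \<theta> * \<bar>c i x\<bar>" if "i \<in> E" for i
  proof -
    have "\<bar>lam i * c i x\<bar> \<le> \<theta> * \<bar>c i x\<bar>"
      using KKT that by (auto simp: reduced_KKT_def abs_mult intro!: mult_right_mono)
    then show ?thesis by linarith
  qed
  moreover have "0 \<le> lam i * c i x + \<theta> * max 0 (- c i x)" if "i \<in> I" for i
  proof (cases "0 \<le> c i x")
    case True
    then show ?thesis using KKT that \<theta> by (simp add: reduced_KKT_def)
  next
    case False
    then have "lam i * (- c i x) \<le> \<theta> * (- c i x)"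
      using KKT that by (intro mult_right_mono) (force simp: reduced_KKT_def)+
    then show ?thesis using False by (simp add: max_def)
  qed
  ultimately have "0 \<le> (\<Sum>i\<in>E. lam i * c i x + \<theta> * \<bar>c i x\<bar>)
      + (\<Sum>i\<in>I. lam i * c i x + \<theta> * max 0 (- c i x))"
    by (rule add_nonneg_nonneg[OF sum_nonneg sum_nonneg])
  then show ?thesis
    unfolding multiplier_gap_def violation_def sum.union_disjoint[OF fin] sum.distrib
      sum_distrib_left[symmetric] by (simp add: algebra_simps)
qed

text \<open>Stationarity is paired with \<open>d\<close>, and complementarity turns each
  \<open>lam i * (grad (c i) x \<bullet> d)\<close> into \<open>- lam i * c i x\<close>. Being an
  exact identity, it serves both the descent estimate and the KL estimate.\<close>

lemma reduced_KKT_slope: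
  "g \<bullet> d = \<theta> * violation E I c x - d \<bullet> (B *v d) - multiplier_gap E I c x lam \<theta>"
proof -
  have "lam i * (grad (c i) x \<bullet> d) = - (lam i * c i x)" if "i \<in> E \<union> I" for i
  proof -
    have "lam i * (c i x + grad (c i) x \<bullet> d) = 0" using KKT that by (simp add: reduced_KKT_def)
    then show ?thesis by (simp add: distrib_left)
  qed
  then have "(\<Sum>i\<in>E \<union> I. lam i *\<^sub>R grad (c i) x) \<bullet> d = - (\<Sum>i\<in>E \<union> I. lam i * c i x)"
    by (simp add: inner_sum_left sum_negf)
  moreover have "g \<bullet> d + d \<bullet> (B *v d) = (\<Sum>i\<in>E \<union> I. lam i *\<^sub>R grad (c i) x) \<bullet> d"
  proof -
    have "g + B *v d = (\<Sum>i\<in>E \<union> I. lam i *\<^sub>R grad (c i) x)"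
      using KKT by (simp add: reduced_KKT_def)
    then show ?thesis by (metis inner_add_left inner_commute)
  qed
  ultimately show ?thesis
    unfolding multiplier_gap_def by linarith
qed

text \<open>The linearization at \<open>x + d\<close> is feasible, so by convexity the linearized
  violation at fraction \<open>s\<close> of the step is at most \<open>1 - s\<close> times the old
  one. Each constraint adds a second-order error.\<close>

lemma violation_step:
  assumes c: "\<And>i. i \<in> E \<union> I \<Longrightarrow> C1_fun (c i) \<and> K-lipschitz_on UNIV (grad (c i))"
    and s: "0 \<le> s" "s \<le> 1"
  shows "violation E I c (x + s *\<^sub>R d)
    \<le> (1 - s) * violation E I c x + real (card E + card I) * K * (s\<^sup>2 * (norm d)\<^sup>2)"
proof -
  define R where "R = K * (s\<^sup>2 * (norm d)\<^sup>2)"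
  have lin: "\<bar>c i (x + s *\<^sub>R d) - c i x - s * (grad (c i) x \<bullet> d)\<bar> \<le> R" if "i \<in> E \<union> I" for i
    using Lipschitz_grad_linearization[of "c i" K x "s *\<^sub>R d"] c[OF that]
    by (simp add: R_def power_mult_distrib)
  have E: "\<bar>c i (x + s *\<^sub>R d)\<bar> \<le> (1 - s) * \<bar>c i x\<bar> + R" if "i \<in> E" for i
  proof -
    have "grad (c i) x \<bullet> d = - c i x" using KKT that by (simp add: reduced_KKT_def eq_neg_iff_add_eq_0 add.commute)
    then have "\<bar>c i (x + s *\<^sub>R d) - (1 - s) * c i x\<bar> \<le> R"
      using lin[of i] that by (simp add: algebra_simps)
    moreover have "\<bar>(1 - s) * c i x\<bar> = (1 - s) * \<bar>c i x\<bar>" using s by (simp add: abs_mult)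
    ultimately show ?thesis by linarith
  qed
  have I: "max 0 (- c i (x + s *\<^sub>R d)) \<le> (1 - s) * max 0 (- c i x) + R" if "i \<in> I" for i
  proof -
    have "0 \<le> s * (c i x + grad (c i) x \<bullet> d)"
      using KKT that s by (simp add: reduced_KKT_def)
    then have "- (s * (grad (c i) x \<bullet> d)) \<le> s * c i x" by (simp add: distrib_left)
    then have "- c i (x + s *\<^sub>R d) \<le> (1 - s) * (- c i x) + R"
      using lin[of i] that by (simp add: algebra_simps abs_le_iff)
    moreover have "(1 - s) * (- c i x) \<le> (1 - s) * max 0 (- c i x)"
      using s by (intro mult_left_mono) auto
    moreover have "0 \<le> (1 - s) * max 0 (- c i x)" using s by simp
    moreover have "0 \<le> R" using lin[of i] that by force
    ultimately show ?thesis by simp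
  qed
  have "violation E I c (x + s *\<^sub>R d)
      \<le> (\<Sum>i\<in>E. (1 - s) * \<bar>c i x\<bar> + R) + (\<Sum>i\<in>I. (1 - s) * max 0 (- c i x) + R)"
    unfolding violation_def using E I by (intro add_mono sum_mono) auto
  also have "\<dots> = (1 - s) * violation E I c x + real (card E + card I) * R"
    unfolding violation_def sum.distrib sum_distrib_left[symmetric]
    by (simp add: algebra_simps)
  finally show ?thesis by (simp add: R_def mult.assoc)
qed

text \<open>The linear loss \<open>s * \<theta> * violation\<close> of the penalty term cancels the
  same quantity in the slope of the objective; what remains to first order is the curvature and the
  gap.\<close>

lemma merit_step:
  assumes c: "\<And>i. i \<in> E \<union> I \<Longrightarrow> C1_fun (c i) \<and> K-lipschitz_on UNIV (grad (c i))"
    and s: "0 \<le> s" "s \<le> 1"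
    and f: "fr (x + s *\<^sub>R d) - fr x - g \<bullet> (s *\<^sub>R d) \<le> \<rho> / 2 * (norm (s *\<^sub>R d))\<^sup>2"
  shows "fr (x + s *\<^sub>R d) + \<theta> * violation E I c (x + s *\<^sub>R d)
    \<le> fr x + \<theta> * violation E I c x
      - s * (d \<bullet> (B *v d) + multiplier_gap E I c x lam \<theta>)
      + (\<rho> / 2 + \<theta> * (real (card E + card I) * K)) * (s\<^sup>2 * (norm d)\<^sup>2)"
proof -
  have "\<theta> * violation E I c (x + s *\<^sub>R d) \<le> \<theta> *
      ((1 - s) * violation E I c x + real (card E + card I) * K * (s\<^sup>2 * (norm d)\<^sup>2))"
    using violation_step[OF c s] \<theta> by (intro mult_left_mono) auto
  moreover have "g \<bullet> (s *\<^sub>R d) = s * (\<theta> * violation E I c x - d \<bullet> (B *v d)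
      - multiplier_gap E I c x lam \<theta>)"
    using reduced_KKT_slope by simp
  ultimately show ?thesis
    using f by (simp add: power_mult_distrib algebra_simps)
qed

end

text \<open>Either the unit step is accepted, or the preceding trial \<open>\<tau> ^ (j - 1)\<close>
  failed and so was at least \<open>s0\<close>.\<close>

lemma backtracking_step_ge:
  fixes \<tau> :: real
  assumes "0 < \<tau>" "\<tau> < 1" "0 < s0"
    and "\<And>s. 0 < s \<Longrightarrow> s \<le> 1 \<Longrightarrow> s \<le> s0 \<Longrightarrow> P s"
    and "\<forall>i<j. \<not> P (\<tau> ^ i)"
  shows "min 1 (\<tau> * s0) \<le> \<tau> ^ j"
proof (cases j)
  case (Suc i)
  then have "\<not> P (\<tau> ^ i)" using assms(5) by simp
  moreover have "0 < \<tau> ^ i" "\<tau> ^ i \<le> 1" using assms by (auto simp: power_le_one)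
  ultimately have "s0 \<le> \<tau> ^ i" using assms(4)[of "\<tau> ^ i"] by linarith
  then show ?thesis using Suc assms(1) by (simp add: min.coboundedI2)
qed simp

section \<open>Value and subgradient of the potential at the points attached to the iterates\<close>

lemma conjugate_pot_F_ge:
  assumes "x \<in> D" "f x = ereal r"
  shows "ereal (y \<bullet> x + r - \<sigma> / 2 * (norm x)\<^sup>2) \<le> conjugate (pot_F f D \<sigma>) y"
proof -
  have "ereal (y \<bullet> x) - pot_F f D \<sigma> x \<le> conjugate (pot_F f D \<sigma>) y"
    unfolding conjugate_def by (rule SUP_upper) simp
  then show ?thesis using assms by (simp add: pot_F_def algebra_simps)
qed

text \<open>The upper quadratic bound says that \<open>\<sigma> x - g\<close> is a subgradient of the convex function
  \<open>pot_F\<close> at \<open>x\<close>, so the Fenchel inequality is an equality.\<close>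

lemma conjugate_pot_F_eq:
  fixes x g :: "real^'n"
  assumes x: "x \<in> D" and f: "\<And>u. u \<in> D \<Longrightarrow> f u = ereal (fr u)"
    and g: "\<And>u. u \<in> D \<Longrightarrow> fr u - fr x - g \<bullet> (u - x) \<le> \<sigma> / 2 * (norm (u - x))\<^sup>2"
  shows "conjugate (pot_F f D \<sigma>) (\<sigma> *\<^sub>R x - g)
    = ereal ((\<sigma> *\<^sub>R x - g) \<bullet> x + fr x - \<sigma> / 2 * (norm x)\<^sup>2)"
proof (rule antisym)
  show "conjugate (pot_F f D \<sigma>) (\<sigma> *\<^sub>R x - g)
      \<le> ereal ((\<sigma> *\<^sub>R x - g) \<bullet> x + fr x - \<sigma> / 2 * (norm x)\<^sup>2)"
    unfolding conjugate_def
  proof (rule SUP_least)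
    fix u
    show "ereal ((\<sigma> *\<^sub>R x - g) \<bullet> u) - pot_F f D \<sigma> u
        \<le> ereal ((\<sigma> *\<^sub>R x - g) \<bullet> x + fr x - \<sigma> / 2 * (norm x)\<^sup>2)"
    proof (cases "u \<in> D")
      case True
      have "(norm (u - x))\<^sup>2 = (norm u)\<^sup>2 - 2 * (x \<bullet> u) + (norm x)\<^sup>2"
        by (simp add: power2_norm_eq_inner inner_diff_left inner_diff_right inner_commute)
      then have "(\<sigma> *\<^sub>R x - g) \<bullet> u - (- fr u + \<sigma> / 2 * (norm u)\<^sup>2)
          \<le> (\<sigma> *\<^sub>R x - g) \<bullet> x + fr x - \<sigma> / 2 * (norm x)\<^sup>2"
        using g[OF True]
        by (simp add: inner_diff_left inner_diff_right power2_norm_eq_inner algebra_simps)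
      then show ?thesis using True f by (simp add: pot_F_def)
    qed (simp add: pot_F_def)
  qed
next
  show "ereal ((\<sigma> *\<^sub>R x - g) \<bullet> x + fr x - \<sigma> / 2 * (norm x)\<^sup>2)
      \<le> conjugate (pot_F f D \<sigma>) (\<sigma> *\<^sub>R x - g)"
    by (rule conjugate_pot_F_ge) (use x f in auto)
qed

text \<open>With the middle argument \<open>\<sigma> *\<^sub>R x - g\<close> the conjugate is known
  exactly, and the cross term of \<open>\<sigma> / 2 * (norm (x + d))\<^sup>2\<close> cancels the
  remaining \<open>\<sigma> * (x \<bullet> d)\<close>.\<close>

lemma potential_value:
  fixes x g d :: "real^'n"
  assumes "x \<in> D" "\<And>u. u \<in> D \<Longrightarrow> f u = ereal (fr u)"
    and "\<And>u. u \<in> D \<Longrightarrow> fr u - fr x - g \<bullet> (u - x) \<le> \<sigma> / 2 * (norm (u - x))\<^sup>2"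
    and "(x + d, x) \<in> lin_constraint_set E I c"
  shows "potential E I f c D \<sigma> l (x + d, \<sigma> *\<^sub>R x - g, x)
    = ereal (fr x + g \<bullet> d + (\<sigma> + l) / 2 * (norm d)\<^sup>2)"
proof -
  have "- ((\<sigma> *\<^sub>R x - g) \<bullet> (x + d)) + ((\<sigma> *\<^sub>R x - g) \<bullet> x + fr x - \<sigma> / 2 * (norm x)\<^sup>2)
      + \<sigma> / 2 * (norm (x + d))\<^sup>2 + l / 2 * (norm d)\<^sup>2
    = fr x + g \<bullet> d + (\<sigma> + l) / 2 * (norm d)\<^sup>2"
    by (simp add: power2_norm_eq_inner inner_add_left inner_add_right inner_diff_left
        inner_commute[of d x] field_simps)
  then show ?thesis
    unfolding potential_def using assms(4) by (simp add: conjugate_pot_F_eq[OF assms(1-3)])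
qed

text \<open>The conjugate is minorized by its affine minorant with slope \<open>x\<close> and the indicator of the
  linearized constraints by minus their Lagrangian; both are exact at the given point.\<close>

lemma potential_regular_subgradient:
  fixes x g d :: "real^'n" and Hs :: "'i \<Rightarrow> real^'n^'n"
  assumes fin: "finite E" "finite I"
    and KKT: "reduced_KKT E I c x g B d lam \<theta>"
    and c: "\<And>i. i \<in> E \<union> I \<Longrightarrow> (c i) differentiable (at x)"
    and Hs: "\<And>i. i \<in> E \<union> I \<Longrightarrow> (grad (c i) has_derivative (\<lambda>u. Hs i *v u)) (at x)"
    and x: "x \<in> D" and f: "\<And>u. u \<in> D \<Longrightarrow> f u = ereal (fr u)"
    and g: "\<And>u. u \<in> D \<Longrightarrow> fr u - fr x - g \<bullet> (u - x) \<le> \<sigma> / 2 * (norm (u - x))\<^sup>2"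
  shows "((\<sigma> + l) *\<^sub>R d - B *v d, - d, - (l *\<^sub>R d) - (\<Sum>i\<in>E \<union> I. lam i *\<^sub>R (d v* Hs i)))
    \<in> regular_subdiff (potential E I f c D \<sigma> l) (x + d, \<sigma> *\<^sub>R x - g, x)"
proof -
  define \<psi> :: "(real^'n) \<times> (real^'n) \<times> (real^'n) \<Rightarrow> real" where
    "\<psi> p = - (fst (snd p) \<bullet> fst p) + (fst (snd p) \<bullet> x + fr x - \<sigma> / 2 * (norm x)\<^sup>2)
      + \<sigma> / 2 * (norm (fst p))\<^sup>2 + l / 2 * (norm (fst p - snd (snd p)))\<^sup>2
      - (\<Sum>i\<in>E \<union> I. lam i * lin_constraint c i (fst p) (snd (snd p)))" for p
  have C: "(x + d, x) \<in> lin_constraint_set E I c"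
    using KKT by (simp add: reduced_KKT_def lin_constraint_set_def lin_constraint_def)
  show ?thesis
  proof (rule smooth_minorant_regular_subdiff[where \<psi> = \<psi>])
    have "lam i * lin_constraint c i (x + d) x = 0" if "i \<in> E \<union> I" for i
      using KKT that by (simp add: reduced_KKT_def lin_constraint_def)
    then have S: "(\<Sum>i\<in>E \<union> I. lam i * lin_constraint c i (x + d) x) = 0" by (rule sum.neutral[OF ballI])
    have "\<psi> (x + d, \<sigma> *\<^sub>R x - g, x) = fr x + g \<bullet> d + (\<sigma> + l) / 2 * (norm d)\<^sup>2"
      unfolding \<psi>_def fst_conv snd_conv S
      by (simp add: power2_norm_eq_inner algebra_simps inner_commute[of d x] add_divide_distrib)
    then show "potential E I f c D \<sigma> l (x + d, \<sigma> *\<^sub>R x - g, x)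
        = ereal (\<psi> (x + d, \<sigma> *\<^sub>R x - g, x))"
      using potential_value[OF x f g C] by simp
  next
    fix p :: "(real^'n) \<times> (real^'n) \<times> (real^'n)"
    obtain x' y' w' where p: "p = (x', y', w')" by (cases p) auto
    define q where "q = y' \<bullet> x + fr x - \<sigma> / 2 * (norm x)\<^sup>2"
    have q: "ereal q \<le> conjugate (pot_F f D \<sigma>) y'"
      unfolding q_def by (rule conjugate_pot_F_ge) (use x f in auto)
    show "ereal (\<psi> p) \<le> potential E I f c D \<sigma> l p"
    proof (cases "(x', w') \<in> lin_constraint_set E I c")
      case True
      \<comment> \<open>On the linearized feasible set the multiplier sum is nonnegative (zero on
        \<open>E\<close>), so subtracting it in \<open>\<psi>\<close> only lowers the value.\<close>
      have "0 \<le> lam i * lin_constraint c i x' w'" if "i \<in> E \<union> I" for i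
        using True KKT that by (auto simp: lin_constraint_set_def reduced_KKT_def)
      then have "0 \<le> (\<Sum>i\<in>E \<union> I. lam i * lin_constraint c i x' w')" by (rule sum_nonneg)
      then have "ereal (\<psi> p) \<le> ereal (- (y' \<bullet> x')) + ereal q
          + ereal (\<sigma> / 2 * (norm x')\<^sup>2) + ereal (l / 2 * (norm (x' - w'))\<^sup>2)"
        by (simp add: \<psi>_def p q_def)
      also have "\<dots> \<le> ereal (- (y' \<bullet> x')) + conjugate (pot_F f D \<sigma>) y'
          + ereal (\<sigma> / 2 * (norm x')\<^sup>2) + ereal (l / 2 * (norm (x' - w'))\<^sup>2)"
        using q by (intro add_mono order_refl)
      finally show ?thesis using True by (simp add: potential_def p)
    next
      case False
      then show ?thesis using q
        by (cases "conjugate (pot_F f D \<sigma>) y'") (auto simp: potential_def p)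
    qed
  next
    \<comment> \<open>In the variable \<open>w\<close> the gradient from \<open>c i w\<close>
      cancels the one from \<open>x - w\<close>, leaving only the Hessian applied to the difference
      \<open>d\<close>; this keeps the third component of order \<open>norm d\<close>. The
      transposed action \<open>v*\<close> avoids appealing to symmetry of the Hessian.\<close>
    have lin: "((\<lambda>p. lin_constraint c i (fst p) (snd (snd p))) has_derivative
        (\<lambda>u. grad (c i) x \<bullet> fst u + (d v* Hs i) \<bullet> snd (snd u))) (at (x + d, \<sigma> *\<^sub>R x - g, x))"
      if i: "i \<in> E \<union> I" for i
    proof -
      let ?z = "(x + d, \<sigma> *\<^sub>R x - g, x)"
      have w: "((\<lambda>p::(real^'n) \<times> (real^'n) \<times> (real^'n). snd (snd p)) has_derivative
          (\<lambda>u. snd (snd u))) (at ?z)"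
        by (auto intro!: derivative_eq_intros)
      have 1: "((\<lambda>p. c i (snd (snd p))) has_derivative
          (\<lambda>u. grad (c i) x \<bullet> snd (snd u))) (at ?z)"
        using has_derivative_compose[OF w, of "c i" "\<lambda>u. grad (c i) x \<bullet> u"]
          has_derivative_grad[OF c[OF i]] by simp
      have 2: "((\<lambda>p. grad (c i) (snd (snd p))) has_derivative
          (\<lambda>u. Hs i *v snd (snd u))) (at ?z)"
        using has_derivative_compose[OF w, of "grad (c i)" "\<lambda>u. Hs i *v u"] Hs[OF i] by simp
      have adj: "(Hs i *v b) \<bullet> d = (d v* Hs i) \<bullet> b" for b
        by (metis dot_lmul_matrix inner_commute)
      have 3: "((\<lambda>p::(real^'n) \<times> (real^'n) \<times> (real^'n). fst p - snd (snd p)) has_derivative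
          (\<lambda>u. fst u - snd (snd u))) (at ?z)"
        by (auto intro!: derivative_eq_intros)
      show ?thesis
        unfolding lin_constraint_def
        by (rule has_derivative_eq_rhs[OF has_derivative_add[OF 1 has_derivative_inner[OF 2 3]]])
           (simp add: fun_eq_iff inner_diff_right adj)
    qed
    \<comment> \<open>Stationarity removes the terms that do not vanish with \<open>d\<close>: the
      first component \<open>- (\<sigma> *\<^sub>R x - g) + \<sigma> *\<^sub>R (x + d) + l *\<^sub>R
      d - (g + B *v d)\<close> loses both \<open>x\<close> and \<open>g\<close>.\<close>
    have eq: "(\<Sum>i\<in>E \<union> I. lam i *\<^sub>R grad (c i) x) = g + B *v d"
      using KKT by (simp add: reduced_KKT_def)
    have split: "(\<Sum>i\<in>E \<union> I. lam i * (grad (c i) x \<bullet> a + (d v* Hs i) \<bullet> b))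
        = (g + B *v d) \<bullet> a + (\<Sum>i\<in>E \<union> I. lam i *\<^sub>R (d v* Hs i)) \<bullet> b" for a b
      by (simp add: eq[symmetric] inner_sum_left sum.distrib distrib_left)
    have "(\<psi> has_derivative (\<lambda>u. - ((\<sigma> *\<^sub>R x - g) \<bullet> fst u + fst (snd u) \<bullet> (x + d))
        + fst (snd u) \<bullet> x + \<sigma> * ((x + d) \<bullet> fst u) + l * (d \<bullet> (fst u - snd (snd u)))
        - (\<Sum>i\<in>E \<union> I. lam i * (grad (c i) x \<bullet> fst u + (d v* Hs i) \<bullet> snd (snd u)))))
        (at (x + d, \<sigma> *\<^sub>R x - g, x))"
    proof -
      have s: "((\<lambda>p. \<Sum>i\<in>E \<union> I. lam i * lin_constraint c i (fst p) (snd (snd p)))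
          has_derivative
          (\<lambda>u. \<Sum>i\<in>E \<union> I. lam i * (grad (c i) x \<bullet> fst u + (d v* Hs i) \<bullet> snd (snd u))))
          (at (x + d, \<sigma> *\<^sub>R x - g, x))"
        by (intro has_derivative_sum has_derivative_mult_right lin)
      have q: "((\<lambda>p::(real^'n) \<times> (real^'n) \<times> (real^'n). - (fst (snd p) \<bullet> fst p)
          + (fst (snd p) \<bullet> x + fr x - \<sigma> / 2 * (x \<bullet> x)) + \<sigma> / 2 * (fst p \<bullet> fst p)
          + l / 2 * ((fst p - snd (snd p)) \<bullet> (fst p - snd (snd p))))
          has_derivative (\<lambda>u. - ((\<sigma> *\<^sub>R x - g) \<bullet> fst u + fst (snd u) \<bullet> (x + d))
          + fst (snd u) \<bullet> x + \<sigma> * ((x + d) \<bullet> fst u) + l * (d \<bullet> (fst u - snd (snd u)))))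
          (at (x + d, \<sigma> *\<^sub>R x - g, x))"
        by (auto intro!: derivative_eq_intros simp: fun_eq_iff inner_commute)
      show ?thesis
        unfolding \<psi>_def power2_norm_eq_inner by (rule has_derivative_diff[OF q s])
    qed
    also have "(\<lambda>u. - ((\<sigma> *\<^sub>R x - g) \<bullet> fst u + fst (snd u) \<bullet> (x + d))
        + fst (snd u) \<bullet> x + \<sigma> * ((x + d) \<bullet> fst u) + l * (d \<bullet> (fst u - snd (snd u)))
        - (\<Sum>i\<in>E \<union> I. lam i * (grad (c i) x \<bullet> fst u + (d v* Hs i) \<bullet> snd (snd u))))
      = (\<bullet>) ((\<sigma> + l) *\<^sub>R d - B *v d, - d,
          - (l *\<^sub>R d) - (\<Sum>i\<in>E \<union> I. lam i *\<^sub>R (d v* Hs i)))"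
      unfolding split
      by (simp add: fun_eq_iff inner_diff_left inner_diff_right inner_add_left
          inner_add_right inner_commute algebra_simps)
    finally show "(\<psi> has_derivative (\<bullet>) ((\<sigma> + l) *\<^sub>R d - B *v d, - d,
        - (l *\<^sub>R d) - (\<Sum>i\<in>E \<union> I. lam i *\<^sub>R (d v* Hs i)))) (at (x + d, \<sigma> *\<^sub>R x - g, x))" .
  qed
qed

section \<open>The merit function along the iterates\<close>

lemma norm_matrix_vector_mult_le:
  fixes A :: "real^'n^'m"
  shows "norm (A *v u) \<le> real CARD('m) * real CARD('n) * norm A * norm u"
proof -
  have "\<bar>A $ i $ j\<bar> \<le> norm A" for i j
    using component_le_norm_cart[of "A $ i" j] Finite_Cartesian_Product.norm_nth_le[of A i] by linarith
  then have "onorm ((*v) A) \<le> real CARD('m) * real CARD('n) * norm A"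
    by (rule onorm_le_matrix_component)
  then have "onorm ((*v) A) * norm u \<le> real CARD('m) * real CARD('n) * norm A * norm u"
    by (rule mult_right_mono) simp
  then show ?thesis
    using onorm[OF matrix_vector_mul_bounded_linear[of A], of u] by linarith
qed

lemma norm_vector_matrix_mult_le:
  fixes A :: "real^'n^'m"
  shows "norm (u v* A) \<le> real CARD('m) * real CARD('n) * norm A * norm u"
proof -
  have "norm (u v* A) * norm (u v* A) = u \<bullet> (A *v (u v* A))"
    by (metis dot_lmul_matrix power2_norm_eq_inner power2_eq_square)
  also have "\<dots> \<le> norm u * (real CARD('m) * real CARD('n) * norm A * norm (u v* A))"
    by (rule order_trans[OF norm_cauchy_schwarz
          mult_left_mono[OF norm_matrix_vector_mult_le norm_ge_zero]])
  finally have "norm (u v* A) * norm (u v* A)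
      \<le> (real CARD('m) * real CARD('n) * norm A * norm u) * norm (u v* A)"
    by (simp add: mult_ac)
  then show ?thesis
    by (cases "norm (u v* A) = 0") (auto simp: mult_le_cancel_right)
qed

lemma compact_continuous_norm_bound:
  assumes "compact D" "continuous_on UNIV h"
  obtains M where "0 \<le> M" "\<And>x. x \<in> D \<Longrightarrow> norm (h x) \<le> M"
proof -
  have "bounded (h ` D)"
    using assms by (meson compact_continuous_image compact_imp_bounded continuous_on_subset top_greatest)
  then obtain M where M: "0 < M" "\<And>x. x \<in> D \<Longrightarrow> norm (h x) \<le> M"
    by (auto simp: bounded_pos)
  then show ?thesis using that[of M] by simp
qed

lemma compact_continuous_norm_bound_family:
  assumes "compact D" "finite J" "\<And>i. i \<in> J \<Longrightarrow> continuous_on UNIV (h i)"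
  obtains M where "0 \<le> M" "\<And>i x. i \<in> J \<Longrightarrow> x \<in> D \<Longrightarrow> norm (h i x) \<le> M"
proof -
  have "\<exists>M. \<forall>i\<in>J. 0 \<le> M i \<and> (\<forall>x\<in>D. norm (h i x) \<le> M i)"
    by (rule bchoice) (metis assms(1,3) compact_continuous_norm_bound)
  then obtain M where M: "\<And>i. i \<in> J \<Longrightarrow> 0 \<le> M i" "\<And>i x. i \<in> J \<Longrightarrow> x \<in> D \<Longrightarrow> norm (h i x) \<le> M i"
    by blast
  have "norm (h i x) \<le> (\<Sum>i\<in>J. M i)" if "i \<in> J" "x \<in> D" for i x
    using M(2)[OF that] member_le_sum[of i J M] that M(1) assms(2) by force
  moreover have "0 \<le> (\<Sum>i\<in>J. M i)" using M(1) by (rule sum_nonneg)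
  ultimately show ?thesis by (rule that[rotated])
qed

lemma norm_sum_scaleR_le:
  fixes h :: "'i \<Rightarrow> 'a::real_normed_vector"
  assumes "\<And>i. i \<in> J \<Longrightarrow> \<bar>lam i\<bar> \<le> \<theta>" "\<And>i. i \<in> J \<Longrightarrow> norm (h i) \<le> M"
  shows "norm (\<Sum>i\<in>J. lam i *\<^sub>R h i) \<le> real (card J) * (\<theta> * M)"
proof -
  have "norm (lam i *\<^sub>R h i) \<le> \<theta> * M" if "i \<in> J" for i
    using assms[OF that] mult_mono[of "\<bar>lam i\<bar>" \<theta> "norm (h i)" M] by force
  then show ?thesis by (rule sum_norm_bound)
qed

text \<open>A step that repairs the linearized constraints must be at least proportional to the
  violation. Hence the violation vanishes along with the steps.\<close>

lemma violation_le_of_linearized_feasible: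
  assumes fin: "finite E" "finite I"
    and KKT: "reduced_KKT E I c x g B d lam \<theta>"
    and G: "\<And>i. i \<in> E \<union> I \<Longrightarrow> norm (grad (c i) x) \<le> G"
  shows "violation E I c x \<le> real (card E + card I) * (G * norm d)"
proof -
  have gd: "\<bar>grad (c i) x \<bullet> d\<bar> \<le> G * norm d" if "i \<in> E \<union> I" for i
    using Cauchy_Schwarz_ineq2[of "grad (c i) x" d] mult_right_mono[OF G[OF that] norm_ge_zero[of d]]
    by linarith
  have "\<bar>c i x\<bar> \<le> G * norm d" if "i \<in> E" for i
  proof -
    have "c i x + grad (c i) x \<bullet> d = 0" using KKT that by (simp add: reduced_KKT_def)
    then show ?thesis using gd[of i] that by auto
  qed
  moreover have "max 0 (- c i x) \<le> G * norm d" if "i \<in> I" for i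
  proof -
    have "0 \<le> c i x + grad (c i) x \<bullet> d" using KKT that by (simp add: reduced_KKT_def)
    then show ?thesis using gd[of i] that by auto
  qed
  ultimately have "violation E I c x \<le> (\<Sum>i\<in>E. G * norm d) + (\<Sum>i\<in>I. G * norm d)"
    unfolding violation_def by (intro add_mono sum_mono)
  then show ?thesis by (simp add: algebra_simps)
qed

text \<open>The KL inequality bounds the potential value, which contains
  \<open>g k \<bullet> d k\<close>. Replacing this slope by \<open>reduced_KKT_slope\<close>
  produces the merit value, minus the curvature and minus the gap, so both reappear on the
  right.\<close>

lemma merit_gap_le:
  fixes E I :: "'i set" and c :: "'i \<Rightarrow> real^'n \<Rightarrow> real" and x g d :: "nat \<Rightarrow> real^'n"
    and B :: "nat \<Rightarrow> real^'n^'n" and lam :: "nat \<Rightarrow> 'i \<Rightarrow> real"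
  assumes fin: "finite E" "finite I" "E \<inter> I = {}"
    and D: "compact D" and f: "\<And>u. u \<in> D \<Longrightarrow> f u = ereal (fr u)" and cf: "continuous_on D fr"
    and sub: "\<And>k u. u \<in> D \<Longrightarrow> fr u - fr (x k) - g k \<bullet> (u - x k) \<le> \<sigma> / 2 * (norm (u - x k))\<^sup>2"
    and xD: "\<And>k. x k \<in> D" and d0: "d \<longlonglongrightarrow> 0"
    and KKT: "\<And>k. reduced_KKT E I c (x k) (g k) (B k) (d k) (lam k) \<theta>" and \<theta>: "0 \<le> \<theta>"
    and B: "bounded (range B)"
    and C2: "\<And>i. i \<in> E \<union> I \<Longrightarrow> C2_fun (c i)"
    and lim: "(\<lambda>k. fr (x k) + \<theta> * violation E I c (x k)) \<longlonglongrightarrow> \<phi>"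
    and \<sigma>: "0 \<le> \<sigma>" and l: "0 \<le> l"
    and KL: "KL_exponent (potential E I f c D \<sigma> l) \<alpha>" and \<alpha>: "0 < \<alpha>" "\<alpha> \<le> 1/2"
  shows "\<exists>C. \<forall>\<^sub>F k in sequentially. fr (x k) + \<theta> * violation E I c (x k) - \<phi>
           \<le> C * (norm (d k))\<^sup>2 + multiplier_gap E I c (x k) (lam k) \<theta>"
proof -
  define J where "J = E \<union> I"
  have J: "finite J" using fin by (simp add: J_def)
  have diff: "(c i) differentiable (at y)" and cgrad: "continuous_on UNIV (grad (c i))"
    if "i \<in> J" for i y
    using C2 that by (auto simp: J_def C2_fun_def C1_fun_def)
  have ccont: "continuous_on UNIV (c i)" if "i \<in> J" for i
    using diff[OF that] by (simp add: continuous_at_imp_continuous_on differentiable_imp_continuous_within)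
  have "\<exists>Hs. \<forall>i\<in>J. (\<forall>y. (grad (c i) has_derivative (\<lambda>u. Hs i y *v u)) (at y)) \<and>
      continuous_on UNIV (Hs i)"
    by (rule bchoice) (use C2 in \<open>auto simp: J_def C2_fun_def\<close>)
  then obtain Hs :: "'i \<Rightarrow> real^'n \<Rightarrow> real^'n^'n" where
    Hs: "\<And>i y. i \<in> J \<Longrightarrow> (grad (c i) has_derivative (\<lambda>u. Hs i y *v u)) (at y)"
    and cHs: "\<And>i. i \<in> J \<Longrightarrow> continuous_on UNIV (Hs i)"
    by blast
  obtain G where G: "0 \<le> G" "\<And>i y. i \<in> J \<Longrightarrow> y \<in> D \<Longrightarrow> norm (grad (c i) y) \<le> G"
    using compact_continuous_norm_bound_family[of D J "\<lambda>i. grad (c i)", OF D J cgrad] by blast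
  obtain M where M: "0 \<le> M" "\<And>i y. i \<in> J \<Longrightarrow> y \<in> D \<Longrightarrow> norm (Hs i y) \<le> M"
    using compact_continuous_norm_bound_family[of D J Hs, OF D J cHs] by blast
  obtain Bb where Bb: "\<And>k. norm (B k) \<le> Bb"
    using B by (auto simp: bounded_iff)
  define N where "N = real CARD('n) * real CARD('n)"
  have N: "0 \<le> N" by (simp add: N_def)
  have Bv: "norm (B k *v u) \<le> N * Bb * norm u" for k u
    using norm_matrix_vector_mult_le[of "B k" u]
      mult_right_mono[OF mult_left_mono[OF Bb[of k] N] norm_ge_zero[of u]]
    unfolding N_def by (rule order_trans)
  have Hv: "norm (u v* Hs i y) \<le> N * M * norm u" if "i \<in> J" "y \<in> D" for i u y
    using norm_vector_matrix_mult_le[of u "Hs i y"]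
      mult_right_mono[OF mult_left_mono[OF M(2)[OF that] N] norm_ge_zero[of u]]
    unfolding N_def by (rule order_trans)

  have nd0: "(\<lambda>k. norm (d k)) \<longlonglongrightarrow> 0" using d0 by (rule tendsto_norm_zero)
  \<comment> \<open>The penalty term vanishes in the limit, so the objective values share the limit
    \<phi> of the merit values.\<close>
  have "(\<lambda>k. violation E I c (x k)) \<longlonglongrightarrow> 0"
  proof (rule tendsto_sandwich[OF _ _ tendsto_const])
    show "(\<lambda>k. real (card E + card I) * (G * norm (d k))) \<longlonglongrightarrow> 0"
      using nd0 by (intro tendsto_mult_right_zero)
    show "\<forall>\<^sub>F k in sequentially. violation E I c (x k) \<le> real (card E + card I) * (G * norm (d k))"
      using violation_le_of_linearized_feasible[OF fin(1,2) KKT] G(2)[OF _ xD] by (simp add: J_def)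
  qed (simp add: violation_nonneg)
  then have "(\<lambda>k. \<theta> * violation E I c (x k)) \<longlonglongrightarrow> 0" by (rule tendsto_mult_right_zero)
  from tendsto_diff[OF lim this] have frlim: "(\<lambda>k. fr (x k)) \<longlonglongrightarrow> \<phi>" by simp

  obtain Db where Db: "\<And>k. norm (d k) \<le> Db"
    using convergent_imp_Bseq[of d] d0 by (auto simp: convergent_def Bseq_def)
  obtain Xb where Xb: "\<And>y. y \<in> D \<Longrightarrow> norm y \<le> Xb"
    using compact_imp_bounded[OF D] by (auto simp: bounded_iff)
  \<comment> \<open>Stationarity expresses \<open>g k\<close> through multipliers bounded by
    \<theta>, constraint gradients and \<open>B k *v d k\<close>, which bounds it uniformly.\<close>
  define Gb where "Gb = real (card J) * (\<theta> * G) + N * Bb * Db"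
  have gb: "norm (g k) \<le> Gb" for k
  proof -
    have "g k = (\<Sum>i\<in>J. lam k i *\<^sub>R grad (c i) (x k)) - B k *v d k"
      using KKT[of k] by (simp add: reduced_KKT_def J_def eq_diff_eq)
    moreover have "norm (\<Sum>i\<in>J. lam k i *\<^sub>R grad (c i) (x k)) \<le> real (card J) * (\<theta> * G)"
      using KKT[of k] G(2) xD by (intro norm_sum_scaleR_le) (auto simp: reduced_KKT_def J_def)
    moreover have "norm (B k *v d k) \<le> N * Bb * Db"
    proof -
      have "0 \<le> N * Bb" using N order_trans[OF norm_ge_zero Bb[of k]] by simp
      from mult_left_mono[OF Db[of k] this] Bv[of k "d k"] show ?thesis by linarith
    qed
    ultimately show ?thesis
      unfolding Gb_def
      using norm_triangle_ineq4[of "\<Sum>i\<in>J. lam k i *\<^sub>R grad (c i) (x k)" "B k *v d k"] by simp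
  qed

  define r where "r k = fr (x k) + g k \<bullet> d k + (\<sigma> + l) / 2 * (norm (d k))\<^sup>2" for k
  define z where "z k = (x k + d k, \<sigma> *\<^sub>R x k - g k, x k)" for k
  define \<xi> where "\<xi> k = ((\<sigma> + l) *\<^sub>R d k - B k *v d k, - d k,
      - (l *\<^sub>R d k) - (\<Sum>i\<in>J. lam k i *\<^sub>R (d k v* Hs i (x k))))" for k
  have "(\<lambda>k. g k \<bullet> d k) \<longlonglongrightarrow> 0"
  proof (rule Lim_null_comparison[OF _ tendsto_mult_right_zero[OF nd0, of Gb]])
    have "norm (g k \<bullet> d k) \<le> Gb * norm (d k)" for k
      using Cauchy_Schwarz_ineq2[of "g k" "d k"] mult_right_mono[OF gb norm_ge_zero[of "d k"]]
      by (simp add: order_trans)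
    then show "\<forall>\<^sub>F k in sequentially. norm (g k \<bullet> d k) \<le> Gb * norm (d k)" by simp
  qed
  moreover have "(\<lambda>k. (\<sigma> + l) / 2 * (norm (d k))\<^sup>2) \<longlonglongrightarrow> (\<sigma> + l) / 2 * 0\<^sup>2"
    by (intro tendsto_intros nd0)
  ultimately have rlim: "r \<longlonglongrightarrow> \<phi>"
    using tendsto_add[OF tendsto_add[OF frlim, of "\<lambda>k. g k \<bullet> d k" 0]] by (fastforce simp: r_def[abs_def])

  have val: "potential E I f c D \<sigma> l (z k) = ereal (r k)" for k
    unfolding z_def r_def
  proof (rule potential_value[OF xD f sub])
    show "(x k + d k, x k) \<in> lin_constraint_set E I c"
      using KKT[of k] by (simp add: reduced_KKT_def lin_constraint_set_def lin_constraint_def)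
  qed
  have subgr: "\<xi> k \<in> regular_subdiff (potential E I f c D \<sigma> l) (z k)" for k
    unfolding z_def \<xi>_def J_def
    using potential_regular_subgradient[OF fin(1,2) KKT[of k] diff Hs xD f sub] J_def by blast

  define C1 where "C1 = (\<sigma> + l + N * Bb) + (1 + (l + real (card J) * (\<theta> * (N * M))))"
  have \<xi>b: "norm (\<xi> k) \<le> C1 * norm (d k)" for k
  proof -
    have "norm (\<Sum>i\<in>J. lam k i *\<^sub>R (d k v* Hs i (x k)))
        \<le> real (card J) * (\<theta> * (N * M * norm (d k)))"
      using KKT[of k] Hv xD by (intro norm_sum_scaleR_le) (auto simp: reduced_KKT_def J_def)
    then have 3: "norm (- (l *\<^sub>R d k) - (\<Sum>i\<in>J. lam k i *\<^sub>R (d k v* Hs i (x k))))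
        \<le> l * norm (d k) + real (card J) * (\<theta> * (N * M * norm (d k)))"
      using l norm_triangle_ineq4[of "- (l *\<^sub>R d k)" "\<Sum>i\<in>J. lam k i *\<^sub>R (d k v* Hs i (x k))"] by simp
    have 1: "norm ((\<sigma> + l) *\<^sub>R d k - B k *v d k) \<le> (\<sigma> + l) * norm (d k) + N * Bb * norm (d k)"
      using \<sigma> l Bv[of k "d k"] norm_triangle_ineq4[of "(\<sigma> + l) *\<^sub>R d k" "B k *v d k"] by simp
    have "norm (\<xi> k) \<le> norm ((\<sigma> + l) *\<^sub>R d k - B k *v d k) + (norm (- d k)
        + norm (- (l *\<^sub>R d k) - (\<Sum>i\<in>J. lam k i *\<^sub>R (d k v* Hs i (x k)))))"
      unfolding \<xi>_def by (intro order_trans[OF norm_Pair_le] add_left_mono norm_Pair_le)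
    also have "\<dots> \<le> ((\<sigma> + l) * norm (d k) + N * Bb * norm (d k)) + (norm (d k)
        + (l * norm (d k) + real (card J) * (\<theta> * (N * M * norm (d k)))))"
      using 1 3 by simp
    also have "\<dots> = C1 * norm (d k)" by (simp add: C1_def algebra_simps)
    finally show ?thesis .
  qed
  have \<xi>0: "\<xi> \<longlonglongrightarrow> 0"
    by (rule Lim_null_comparison[OF _ tendsto_mult_right_zero[OF nd0, of C1]]) (simp add: \<xi>b)
  have zb: "bounded (range z)"
  proof -
    have "norm (z k) \<le> (Xb + Db) + ((\<sigma> * Xb + Gb) + Xb)" for k
    proof -
      have "norm (z k) \<le> norm (x k + d k) + (norm (\<sigma> *\<^sub>R x k - g k) + norm (x k))"
        unfolding z_def by (intro order_trans[OF norm_Pair_le] add_left_mono norm_Pair_le)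
      moreover have "norm (x k + d k) \<le> Xb + Db"
        using norm_triangle_ineq[of "x k" "d k"] Xb[OF xD[of k]] Db[of k] by linarith
      moreover have "norm (\<sigma> *\<^sub>R x k - g k) \<le> \<sigma> * Xb + Gb"
        using norm_triangle_ineq4[of "\<sigma> *\<^sub>R x k" "g k"] gb[of k]
          mult_left_mono[OF Xb[OF xD[of k]] \<sigma>] \<sigma> by simp
      ultimately show ?thesis using Xb[OF xD[of k]] by linarith
    qed
    then show ?thesis by (auto simp: bounded_iff)
  qed

  \<comment> \<open>The quadratic upper bound with slope \<open>g\<close> is closed under limits, as
    are the linearized constraints. With steps tending to 0, the limit is therefore again a point
    covered by \<open>potential_value\<close>, now with \<open>d = 0\<close>, and its value is
    \<open>fr y = \<phi>\<close>.\<close>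
  have acc: "potential E I f c D \<sigma> l p = ereal \<phi>" if accp: "accumulation_point z p" for p
  proof -
    obtain s where s: "strict_mono s" "(z \<circ> s) \<longlonglongrightarrow> p"
      using accp by (auto simp: accumulation_point_def)
    obtain p1 p2 y where p: "p = (p1, p2, y)" by (cases p) auto
    have xs: "(\<lambda>k. x (s k)) \<longlonglongrightarrow> y" and gs': "(\<lambda>k. \<sigma> *\<^sub>R x (s k) - g (s k)) \<longlonglongrightarrow> p2"
      and xds: "(\<lambda>k. x (s k) + d (s k)) \<longlonglongrightarrow> p1"
      using tendsto_snd[OF tendsto_snd[OF s(2)]] tendsto_fst[OF tendsto_snd[OF s(2)]]
        tendsto_fst[OF s(2)] by (simp_all add: z_def p o_def)
    have ds: "(\<lambda>k. d (s k)) \<longlonglongrightarrow> 0"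
      using LIMSEQ_subseq_LIMSEQ[OF d0 s(1)] by (simp add: o_def)
    have p1: "p1 = y"
      using tendsto_add[OF xs ds] xds LIMSEQ_unique by auto
    define gy where "gy = \<sigma> *\<^sub>R y - p2"
    have gs: "(\<lambda>k. g (s k)) \<longlonglongrightarrow> gy"
      using tendsto_diff[OF tendsto_scaleR[OF tendsto_const xs, of \<sigma>] gs'] by (simp add: gy_def)
    have yD: "y \<in> D"
      using closed_sequentially[OF compact_imp_closed[OF D] _ xs] xD by blast
    have frs: "(\<lambda>k. fr (x (s k))) \<longlonglongrightarrow> fr y"
      using continuous_on_tendsto_compose[OF cf xs yD] xD by simp
    have fry: "fr y = \<phi>"
      using frs LIMSEQ_subseq_LIMSEQ[OF frlim s(1)] LIMSEQ_unique by (fastforce simp: o_def)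
    have suby: "fr u - fr y - gy \<bullet> (u - y) \<le> \<sigma> / 2 * (norm (u - y))\<^sup>2" if "u \<in> D" for u
    proof (rule LIMSEQ_le)
      show "(\<lambda>k. fr u - fr (x (s k)) - g (s k) \<bullet> (u - x (s k))) \<longlonglongrightarrow> fr u - fr y - gy \<bullet> (u - y)"
        by (intro tendsto_intros frs gs xs)
      show "(\<lambda>k. \<sigma> / 2 * (norm (u - x (s k)))\<^sup>2) \<longlonglongrightarrow> \<sigma> / 2 * (norm (u - y))\<^sup>2"
        by (intro tendsto_intros xs)
    qed (use sub[OF that] in blast)
    have cs: "(\<lambda>k. c i (x (s k)) + grad (c i) (x (s k)) \<bullet> d (s k)) \<longlonglongrightarrow> c i y" if "i \<in> J" for i
    proof -
      have "(\<lambda>k. c i (x (s k))) \<longlonglongrightarrow> c i y" "(\<lambda>k. grad (c i) (x (s k))) \<longlonglongrightarrow> grad (c i) y"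
        using continuous_on_tendsto_compose[OF ccont[OF that] xs]
          continuous_on_tendsto_compose[OF cgrad[OF that] xs] by auto
      from tendsto_add[OF this(1) tendsto_inner[OF this(2) ds]] show ?thesis by simp
    qed
    have "c i y = 0" if "i \<in> E" for i
    proof -
      have "(\<lambda>k. c i (x (s k)) + grad (c i) (x (s k)) \<bullet> d (s k)) = (\<lambda>k. 0)"
        using KKT that by (auto simp: reduced_KKT_def)
      then show ?thesis using cs[of i] that by (simp add: J_def LIMSEQ_const_iff)
    qed
    moreover have "0 \<le> c i y" if "i \<in> I" for i
      using cs[of i] that KKT by (intro LIMSEQ_le_const) (auto simp: reduced_KKT_def J_def)
    ultimately have "(y + 0, y) \<in> lin_constraint_set E I c"
      by (simp add: lin_constraint_set_def lin_constraint_def)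
    from potential_value[where d = 0, OF yD f suby this, of l] fry
    show ?thesis by (simp add: p p1 gy_def)
  qed

  obtain C where "\<forall>\<^sub>F k in sequentially. r k - \<phi> \<le> C * (norm (\<xi> k))\<^sup>2"
    using KL_exponent_quadratic_bound[OF KL \<alpha> zb val rlim subgr \<xi>0 acc] by blast
  then have "\<forall>\<^sub>F k in sequentially. fr (x k) + \<theta> * violation E I c (x k) - \<phi>
      \<le> (\<bar>C\<bar> * C1\<^sup>2 + N * Bb) * (norm (d k))\<^sup>2 + multiplier_gap E I c (x k) (lam k) \<theta>"
  proof eventually_elim
    case (elim k)
    \<comment> \<open>\<open>C\<close> may be negative, so its absolute value is used before
      \<open>\<xi>b\<close> is inserted.\<close>
    have "r k - \<phi> \<le> \<bar>C\<bar> * (norm (\<xi> k))\<^sup>2"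
      using elim mult_right_mono[OF abs_ge_self[of C] zero_le_power2[of "norm (\<xi> k)"]] by linarith
    also have "\<dots> \<le> \<bar>C\<bar> * (C1 * norm (d k))\<^sup>2"
      using \<xi>b[of k] by (intro mult_left_mono power_mono) auto
    finally have 1: "r k - \<phi> \<le> \<bar>C\<bar> * C1\<^sup>2 * (norm (d k))\<^sup>2" by (simp add: power_mult_distrib)
    have 2: "d k \<bullet> (B k *v d k) \<le> N * Bb * (norm (d k))\<^sup>2"
      using norm_cauchy_schwarz[of "d k" "B k *v d k"] mult_left_mono[OF Bv[of k "d k"] norm_ge_zero[of "d k"]]
      by (simp add: power2_eq_square mult_ac)
    have "0 \<le> (\<sigma> + l) / 2 * (norm (d k))\<^sup>2" using \<sigma> l by simp
    then show ?case
      using 1[unfolded r_def] 2 reduced_KKT_slope[OF fin KKT[of k] \<theta>]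
      unfolding distrib_right[of _ _ "(norm (d k))\<^sup>2"] by linarith
  qed
  then show ?thesis by blast
qed

text \<open>A convex combination of the two decreases controls both \<open>n\<close> and
  \<open>G\<close>: with a small weight on the second one, its loss \<open>M * n\<close> is absorbed
  by \<open>c1 * n\<close>. The result dominates a multiple of \<open>\<bar>C\<bar> * n + G\<close>
  and hence of \<open>\<Delta>\<close>.\<close>

lemma contraction_from_two_decreases:
  fixes C M c1 \<kappa> :: real
  assumes "0 < c1" "0 < M" "0 < \<kappa>" "\<kappa> \<le> 1"
  obtains q where "0 < q" "q < 1"
    "\<And>\<Delta> \<Delta>' n G. \<lbrakk>c1 * n \<le> \<Delta> - \<Delta>'; \<kappa> * G - M * n \<le> \<Delta> - \<Delta>'; \<Delta> \<le> C * n + G; 0 \<le> n; 0 \<le> G\<rbrakk>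
      \<Longrightarrow> \<Delta>' \<le> q * \<Delta>"
proof -
  \<comment> \<open>This weight leaves exactly \<open>c1 / 2\<close> as the coefficient of
    \<open>n\<close>.\<close>
  define s where "s = c1 / (2 * (c1 + M))"
  have s: "0 < s" "s \<le> 1 / 2" "s * (c1 + M) = c1 / 2"
    using assms by (auto simp: s_def field_simps)
  \<comment> \<open>The first bound serves the \<open>G\<close> term, the second the
    \<open>n\<close> term; adding 1 keeps the denominator positive when
    \<open>C = 0\<close>.\<close>
  define \<mu> where "\<mu> = min (s * \<kappa>) (c1 / (2 * (\<bar>C\<bar> + 1)))"
  have "s * \<kappa> \<le> 1 / 2" using s mult_mono[of s "1/2" \<kappa> 1] assms by simp
  then have \<mu>: "0 < \<mu>" "\<mu> < 1" "\<mu> \<le> s * \<kappa>" "\<mu> \<le> c1 / (2 * (\<bar>C\<bar> + 1))"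
    using s assms by (auto simp: \<mu>_def min_less_iff_disj)
  have \<mu>C: "\<mu> * \<bar>C\<bar> \<le> c1 / 2"
  proof -
    have "\<mu> * (\<bar>C\<bar> + 1) \<le> c1 / 2" using \<mu>(4) by (simp add: field_simps)
    then show ?thesis using \<mu>(1) by (simp add: distrib_left)
  qed
  show thesis
  proof (rule that[of "1 - \<mu>"])
    fix \<Delta> \<Delta>' n G :: real
    assume h: "c1 * n \<le> \<Delta> - \<Delta>'" "\<kappa> * G - M * n \<le> \<Delta> - \<Delta>'" "\<Delta> \<le> C * n + G" "0 \<le> n" "0 \<le> G"
    have "s * (\<kappa> * G - M * n) \<le> s * (\<Delta> - \<Delta>')" "(1 - s) * (c1 * n) \<le> (1 - s) * (\<Delta> - \<Delta>')"
      using h s by (auto intro!: mult_left_mono)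
    then have "s * \<kappa> * G + (c1 - s * (c1 + M)) * n \<le> \<Delta> - \<Delta>'" by (simp add: algebra_simps)
    then have "s * \<kappa> * G + c1 / 2 * n \<le> \<Delta> - \<Delta>'" by (simp add: s(3))
    moreover have "\<mu> * G \<le> s * \<kappa> * G" using \<mu>(3) h(5) by (rule mult_right_mono)
    moreover have "\<mu> * \<bar>C\<bar> * n \<le> c1 / 2 * n" using \<mu>C h(4) by (rule mult_right_mono)
    moreover have "\<mu> * \<Delta> \<le> \<mu> * (\<bar>C\<bar> * n + G)"
      using h mult_right_mono[OF abs_ge_self[of C] h(4)] \<mu>(1) by (intro mult_left_mono) auto
    ultimately show "\<Delta>' \<le> (1 - \<mu>) * \<Delta>" by (simp add: distrib_left left_diff_distrib mult.assoc)
  qed (use \<mu> in auto)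
qed

lemma sqp_run_pos_penalty:
  assumes "sqp_run E I f c \<eta> \<tau> \<gamma> x \<theta> g B d v w t lam a"
  shows "0 < \<theta> k"
proof (induction k)
  case 0
  then show ?case using assms by (simp add: sqp_run_def)
next
  case (Suc k)
  have "\<theta> k \<le> \<theta> (Suc k)" using assms unfolding sqp_run_def by (metis max.cobounded1)
  then show ?case using Suc by linarith
qed

theorem theorem5p18:
  fixes E I :: "'i set"
    and f :: "real^'n \<Rightarrow> ereal"
    and c :: "'i \<Rightarrow> real^'n \<Rightarrow> real"
    and D :: "(real^'n) set"
    and x g d :: "nat \<Rightarrow> real^'n"
    and B :: "nat \<Rightarrow> real^'n^'n"
    and v w t lam :: "nat \<Rightarrow> 'i \<Rightarrow> real"
    and \<theta> a :: "nat \<Rightarrow> real"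
    and \<eta> \<tau> \<gamma> \<rho> H b c\<^sub>b \<theta>bar \<sigma> l \<alpha> :: real
  assumes "finite E" and "finite I" and "E \<inter> I = {}"
    and "\<And>y. f y \<noteq> -\<infinity>"
    and "assumption_A1 TYPE('t) D f \<rho>"
    and "assumption_A2 E I c H"
    and "assumption_A3 E I c D x d B b"
    and "sqp_run E I f c \<eta> \<tau> \<gamma> x \<theta> g B d v w t lam a"
    and "\<And>p. accumulation_point x p \<Longrightarrow> MFCQ E I c p"
    and "\<forall>\<^sub>F k in sequentially. \<theta> k = \<theta>bar"
    and "0 < \<sigma>" and "0 < l"
    and "convex_on D (\<lambda>y. real_of_ereal (pot_F f D \<sigma> y))"
    and "KL_function (potential E I f c D \<sigma> l)"
    and "\<And>i. i \<in> E \<union> I \<Longrightarrow> C2_fun (c i)"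
    and "0 < c\<^sub>b" and "c\<^sub>b < 1"
    and "c\<^sub>b * b - \<theta>bar * (real (card E + card I) * H) \<ge> 0"
    and "2 * b \<ge> l + \<sigma>"
    and "l / c\<^sub>b > b" and "b \<ge> \<sigma>" and "\<sigma> \<ge> \<rho>"
    and "0 \<le> \<alpha>" and "\<alpha> < 1"
    and "KL_exponent (potential E I f c D \<sigma> l) \<alpha>"
    and "0 < \<alpha>" and "\<alpha> \<le> 1 / 2"
  shows "\<exists>xbar. x \<longlonglongrightarrow> xbar \<and>
           (\<exists>q\<^sub>0 q\<^sub>1. 0 < q\<^sub>0 \<and> q\<^sub>0 < 1 \<and> 0 < q\<^sub>1 \<and>
              (\<forall>\<^sub>F k in sequentially. norm (x k - xbar) \<le> q\<^sub>1 * q\<^sub>0 ^ k))"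
proof -
  define J where "J = E \<union> I"
  define fr where "fr u = real_of_ereal (f u)" for u
  define \<Phi> where "\<Phi> u = fr u + \<theta>bar * violation E I c u" for u
  have fin: "finite E" "finite I" "E \<inter> I = {}" by fact+
  note run = \<open>sqp_run E I f c \<eta> \<tau> \<gamma> x \<theta> g B d v w t lam a\<close>
  have \<eta>: "0 < \<eta>" "\<eta> < 1" and \<tau>: "0 < \<tau>" "\<tau> < 1"
    and gcl: "\<And>k. g k \<in> clarke_subdiff f (x k)" and xSuc: "\<And>k. x (Suc k) = x k + a k *\<^sub>R d k"
    using run by (auto simp: sqp_run_def)
  have D: "convex D" "compact D" and xD: "\<And>k. x k \<in> D" and xdD: "\<And>k. x k + d k \<in> D"
    and B: "bounded (range B)" and b: "0 < b" "\<And>k u. b * (norm u)\<^sup>2 \<le> u \<bullet> (B k *v u)"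
    using \<open>assumption_A3 E I c D x d B b\<close> by (auto simp: assumption_A3_def)
  note A1 = \<open>assumption_A1 TYPE('t) D f \<rho>\<close>[unfolded assumption_A1_def, folded fr_def]
  from A1 obtain S L where S: "D \<subseteq> S" "\<forall>u\<in>S. \<bar>f u\<bar> \<noteq> \<infinity>" and L: "L-lipschitz_on S fr"
    by (elim conjE exE) (rule that)
  from A1 have \<rho>: "0 < \<rho>" by (elim conjE)
  from A1 have up: "fr u - fr y - p \<bullet> (u - y) \<le> \<rho> / 2 * (norm (u - y))\<^sup>2"
    if "u \<in> D" "y \<in> D" "p \<in> clarke_subdiff f y" for u y p
    using that by (elim conjE) (drule (1) bspec)+
  have f: "f u = ereal (fr u)" if "u \<in> D" for u
    using S that by (simp add: fr_def ereal_real' subset_iff)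
  have cf: "continuous_on D fr"
    using lipschitz_on_continuous_on[OF L] S(1) by (rule continuous_on_subset)
  have sub: "fr u - fr (x k) - g k \<bullet> (u - x k) \<le> \<sigma> / 2 * (norm (u - x k))\<^sup>2" if "u \<in> D" for u k
    using up[OF that xD gcl, of k] mult_right_mono[of "\<rho> / 2" "\<sigma> / 2" "(norm (u - x k))\<^sup>2"]
      \<open>\<sigma> \<ge> \<rho>\<close> by simp
  obtain N where N: "\<And>k. k \<ge> N \<Longrightarrow> \<theta> k = \<theta>bar"
    using \<open>\<forall>\<^sub>F k in sequentially. \<theta> k = \<theta>bar\<close> by (auto simp: eventually_sequentially)
  have \<theta>: "0 \<le> \<theta>bar" using sqp_run_pos_penalty[OF run, of N] N[of N] by simp
  have KKT: "reduced_KKT E I c (x k) (g k) (B k) (d k) (lam (Suc k)) \<theta>bar" if "k \<ge> N" for k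
    using sqp_run_reduced_KKT[OF fin(1,2) run, of k] N[of k] N[of "Suc k"] that by simp
  have "\<exists>K. \<forall>i\<in>J. (K i)-lipschitz_on UNIV (grad (c i))"
    by (rule bchoice) (use \<open>assumption_A2 E I c H\<close> in \<open>auto simp: assumption_A2_def J_def\<close>)
  then obtain K where K: "\<And>i. i \<in> J \<Longrightarrow> (K i)-lipschitz_on UNIV (grad (c i))" by blast
  \<comment> \<open>The sum is a common Lipschitz constant for the finitely many gradients, also
    when \<open>J\<close> is empty.\<close>
  define Ks where "Ks = (\<Sum>i\<in>J. K i)"
  have K0: "0 \<le> K i" if "i \<in> J" for i using K[OF that] by (rule lipschitz_on_nonneg)
  have Ks: "0 \<le> Ks" unfolding Ks_def using K0 by (rule sum_nonneg)
  have c: "C1_fun (c i) \<and> Ks-lipschitz_on UNIV (grad (c i))" if "i \<in> E \<union> I" for i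
  proof -
    have i: "i \<in> J" using that by (simp add: J_def)
    have "K i \<le> Ks" unfolding Ks_def using fin K0 i by (intro member_le_sum) (auto simp: J_def)
    then show ?thesis
      using lipschitz_on_le[OF K[OF i]] \<open>assumption_A2 E I c H\<close> that by (auto simp: assumption_A2_def)
  qed
  define M where "M = \<rho> / 2 + \<theta>bar * (real (card E + card I) * Ks)"
  have M: "0 < M" unfolding M_def using \<rho> \<theta> Ks by (intro add_pos_nonneg mult_nonneg_nonneg) auto
  define gap where "gap k = multiplier_gap E I c (x k) (lam (Suc k)) \<theta>bar" for k
  have gap: "0 \<le> gap k" if "k \<ge> N" for k
    unfolding gap_def by (rule multiplier_gap_nonneg[OF fin KKT[OF that] \<theta>])

  \<comment> \<open>Line search: step sizes bounded away from zero\<close>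
  have segD: "x k + s *\<^sub>R d k \<in> D" if "0 \<le> s" "s \<le> 1" for k s
  proof -
    have "x k + s *\<^sub>R d k = (1 - s) *\<^sub>R x k + s *\<^sub>R (x k + d k)" by (simp add: algebra_simps)
    then show ?thesis using D(1) xD xdD that by (auto intro: convexD)
  qed
  have step: "\<Phi> (x k + s *\<^sub>R d k) \<le> \<Phi> (x k) - s * (d k \<bullet> (B k *v d k) + gap k) + M * (s\<^sup>2 * (norm (d k))\<^sup>2)"
    if "k \<ge> N" "0 \<le> s" "s \<le> 1" for k s
  proof -
    have "fr (x k + s *\<^sub>R d k) - fr (x k) - g k \<bullet> (s *\<^sub>R d k) \<le> \<rho> / 2 * (norm (s *\<^sub>R d k))\<^sup>2"
      using up[OF segD[OF that(2,3), of k] xD[of k] gcl[of k]] unfolding add_diff_cancel_left' .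
    from merit_step[OF fin KKT[OF that(1)] \<theta> c that(2,3) this] show ?thesis
      unfolding \<Phi>_def gap_def M_def .
  qed
  have suff: "sufficient_decrease E I f c \<eta> (x k) (B k) (\<theta> k) (d k) s \<longleftrightarrow>
      \<eta> * s * (1 / 2) * (d k \<bullet> (B k *v d k)) \<le> \<Phi> (x k) - \<Phi> (x k + s *\<^sub>R d k)"
    if "k \<ge> N" "0 \<le> s" "s \<le> 1" for k s
    unfolding sufficient_decrease_def merit_def \<Phi>_def
    by (simp add: f[OF xD] f[OF segD[OF that(2,3)]] N[OF that(1)])
  \<comment> \<open>For \<open>s\<close> up to this threshold the second-order error is at most half
    of the linear decrease; the other half exceeds what the test demands because \<eta> < 1.\<close>
  define s0 where "s0 = b / (2 * M)"
  have s0: "0 < s0" using b M by (simp add: s0_def)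
  have suff_small: "sufficient_decrease E I f c \<eta> (x k) (B k) (\<theta> k) (d k) s"
    if k: "k \<ge> N" and s: "0 < s" "s \<le> 1" "s \<le> s0" for k s
  proof -
    have "M * s \<le> b / 2" using s(3) M by (simp add: s0_def field_simps)
    then have "s * (M * s * (norm (d k))\<^sup>2) \<le> s * (b / 2 * (norm (d k))\<^sup>2)"
      using s by (intro mult_left_mono mult_right_mono) auto
    also have "\<dots> \<le> s * (1 / 2 * (d k \<bullet> (B k *v d k)))"
      using s b(2)[of "d k" k] by (intro mult_left_mono) auto
    finally have "M * (s\<^sup>2 * (norm (d k))\<^sup>2) \<le> s * (1 / 2) * (d k \<bullet> (B k *v d k))"
      by (simp add: power2_eq_square mult_ac)
    moreover have "0 \<le> d k \<bullet> (B k *v d k)"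
      using b(2)[of "d k" k] b(1) by (meson mult_nonneg_nonneg less_imp_le order_trans zero_le_power2)
    then have "\<eta> * (s * (1 / 2) * (d k \<bullet> (B k *v d k))) \<le> 1 * (s * (1 / 2) * (d k \<bullet> (B k *v d k)))"
      using \<eta> s by (intro mult_right_mono) auto
    moreover have "0 \<le> s * gap k" using s gap[OF k] by simp
    moreover have "\<eta> * s * (1 / 2) * (d k \<bullet> (B k *v d k)) = \<eta> * (s * (1 / 2) * (d k \<bullet> (B k *v d k)))"
      and "s * (d k \<bullet> (B k *v d k) + gap k) = 2 * (s * (1 / 2) * (d k \<bullet> (B k *v d k))) + s * gap k"
      by (simp_all add: distrib_left)
    ultimately show ?thesis
      using suff[OF k, of s] step[OF k, of s] s by linarith
  qed
  define am where "am = min 1 (\<tau> * s0)"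
  have am: "0 < am" "am \<le> 1" using \<tau> s0 by (auto simp: am_def)
  have a: "am \<le> a k" "a k \<le> 1" "sufficient_decrease E I f c \<eta> (x k) (B k) (\<theta> k) (d k) (a k)"
    if k: "k \<ge> N" for k
  proof -
    obtain j where j: "a k = \<tau> ^ j" "sufficient_decrease E I f c \<eta> (x k) (B k) (\<theta> k) (d k) (\<tau> ^ j)"
      "\<forall>i<j. \<not> sufficient_decrease E I f c \<eta> (x k) (B k) (\<theta> k) (d k) (\<tau> ^ i)"
      using run unfolding sqp_run_def by blast
    show "am \<le> a k" unfolding am_def j(1)
      by (rule backtracking_step_ge[OF \<tau> s0 suff_small[OF k] j(3)])
    show "a k \<le> 1" using \<tau> by (simp add: j(1) power_le_one)
    show "sufficient_decrease E I f c \<eta> (x k) (B k) (\<theta> k) (d k) (a k)" using j by simp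
  qed

  \<comment> \<open>Two lower bounds for the decrease of the merit function\<close>
  define c1 where "c1 = \<eta> * am * (1 / 2) * b"
  have c1: "0 < c1" using \<eta> am b by (simp add: c1_def)
  have dec1: "c1 * (norm (d k))\<^sup>2 \<le> \<Phi> (x k) - \<Phi> (x (Suc k))" if k: "k \<ge> N" for k
  proof -
    have "c1 * (norm (d k))\<^sup>2 = \<eta> * am * (1 / 2) * (b * (norm (d k))\<^sup>2)" by (simp add: c1_def)
    also have "\<dots> \<le> \<eta> * a k * (1 / 2) * (d k \<bullet> (B k *v d k))"
      using \<eta> am a[OF k] b by (intro mult_mono) auto
    also have "\<dots> \<le> \<Phi> (x k) - \<Phi> (x (Suc k))"
      using suff[OF k, of "a k"] a[OF k] am by (simp add: xSuc)
    finally show ?thesis .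
  qed
  \<comment> \<open>The acceptance test contains no gap term, so this bound comes from
    \<open>step\<close> at the accepted step size, with the curvature term dropped.\<close>
  have dec2: "am * gap k - M * (norm (d k))\<^sup>2 \<le> \<Phi> (x k) - \<Phi> (x (Suc k))" if k: "k \<ge> N" for k
  proof -
    have ak: "0 \<le> a k" "a k \<le> 1" using a[OF k] am by auto
    have "am * gap k \<le> a k * gap k" using a(1)[OF k] gap[OF k] by (rule mult_right_mono)
    moreover have "0 \<le> a k * (d k \<bullet> (B k *v d k))"
      using ak b(2)[of "d k" k] b(1) by (meson mult_nonneg_nonneg less_imp_le order_trans zero_le_power2)
    moreover have "M * ((a k)\<^sup>2 * (norm (d k))\<^sup>2) \<le> M * (1 * (norm (d k))\<^sup>2)"
      using ak M by (intro mult_left_mono mult_right_mono) (auto simp: power_le_one)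
    ultimately show ?thesis
      using step[OF k ak] by (simp add: xSuc distrib_left)
  qed

  \<comment> \<open>Convergence of the merit values and contraction of their distance to the
    limit\<close>
  have "bounded (fr ` D)" using compact_continuous_image[OF cf D(2)] by (rule compact_imp_bounded)
  then obtain Fb where Fb: "\<And>u. u \<in> D \<Longrightarrow> \<bar>fr u\<bar> \<le> Fb" by (auto simp: bounded_iff)
  have "- Fb \<le> \<Phi> (x k)" for k
    using Fb[OF xD[of k]] mult_nonneg_nonneg[OF \<theta> violation_nonneg[of E I c "x k"]]
    unfolding \<Phi>_def by linarith
  moreover have mono: "\<Phi> (x (Suc k)) \<le> \<Phi> (x k)" if "k \<ge> N" for k
  proof -
    have "0 \<le> c1 * (norm (d k))\<^sup>2" using c1 by simp
    then show ?thesis using dec1[OF that] by linarith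
  qed
  then have "decseq (\<lambda>k. \<Phi> (x (k + N)))" by (intro decseq_SucI) simp
  ultimately obtain \<phi> where lim: "(\<lambda>k. \<Phi> (x (k + N))) \<longlonglongrightarrow> \<phi>" and ge: "\<And>k. \<phi> \<le> \<Phi> (x (k + N))"
    using decseq_convergent[of "\<lambda>k. \<Phi> (x (k + N))" "- Fb"] by blast
  have "(\<lambda>k. (norm (d (k + N)))\<^sup>2) \<longlonglongrightarrow> 0"
  proof (rule tendsto_sandwich[OF _ _ tendsto_const])
    have "(\<lambda>k. \<Phi> (x (k + N)) - \<Phi> (x (Suc k + N))) \<longlonglongrightarrow> 0"
      using tendsto_diff[OF lim LIMSEQ_Suc[OF lim]] by simp
    then show "(\<lambda>k. 1 / c1 * (\<Phi> (x (k + N)) - \<Phi> (x (Suc (k + N))))) \<longlonglongrightarrow> 0"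
      by (intro tendsto_mult_right_zero) simp
    show "\<forall>\<^sub>F k in sequentially.
        (norm (d (k + N)))\<^sup>2 \<le> 1 / c1 * (\<Phi> (x (k + N)) - \<Phi> (x (Suc (k + N))))"
      using dec1 c1 by (simp add: field_simps)
  qed simp
  then have d0: "(\<lambda>k. d (k + N)) \<longlonglongrightarrow> 0"
    using tendsto_real_sqrt[of "\<lambda>k. (norm (d (k + N)))\<^sup>2" 0] by (simp add: tendsto_norm_zero_iff)
  have B': "bounded (range (\<lambda>k. B (k + N)))" using B by (rule bounded_subset) auto
  \<comment> \<open>The sequences are shifted by \<open>N\<close> so that the reduced optimality
    system holds at every index; the multiplier of iteration \<open>k\<close> is
    \<open>lam (Suc k)\<close>.\<close>
  have "\<exists>C. \<forall>\<^sub>F k in sequentially. \<Phi> (x (k + N)) - \<phi> \<le> C * (norm (d (k + N)))\<^sup>2 + gap (k + N)"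
    unfolding \<Phi>_def gap_def
    by (rule merit_gap_le[where f = f and D = D and g = "\<lambda>k. g (k + N)" and B = "\<lambda>k. B (k + N)"
          and \<sigma> = \<sigma> and l = l and \<alpha> = \<alpha>])
       (use fin D f cf sub xD d0 KKT \<theta> B' assms lim in \<open>auto simp: \<Phi>_def\<close>)
  then obtain C N1 where C: "\<And>k. k \<ge> N1 \<Longrightarrow>
      \<Phi> (x (k + N)) - \<phi> \<le> C * (norm (d (k + N)))\<^sup>2 + gap (k + N)"
    by (auto simp: eventually_sequentially)
  obtain q where q: "0 < q" "q < 1" and contr:
    "\<And>\<Delta> \<Delta>' n G. \<lbrakk>c1 * n \<le> \<Delta> - \<Delta>'; am * G - M * n \<le> \<Delta> - \<Delta>'; \<Delta> \<le> C * n + G; 0 \<le> n; 0 \<le> G\<rbrakk>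
      \<Longrightarrow> \<Delta>' \<le> q * \<Delta>"
    using contraction_from_two_decreases[OF c1 M am] by blast
  show ?thesis
  proof (rule linear_rate[OF q c1, where N = "N1 + N" and \<Delta> = "\<lambda>k. \<Phi> (x k) - \<phi>"])
    fix k assume "N1 + N \<le> k"
    then have k: "k \<ge> N" and k': "k - N \<ge> N1" "k - N + N = k" by auto
    show "\<Phi> (x (Suc k)) - \<phi> \<le> q * (\<Phi> (x k) - \<phi>)"
      by (rule contr[of "(norm (d k))\<^sup>2" _ _ "gap k"])
         (use dec1[OF k] dec2[OF k] C[OF k'(1)] k'(2) gap[OF k] in auto)
    have "(norm (x (Suc k) - x k))\<^sup>2 \<le> (norm (d k))\<^sup>2"
      using a(1,2)[OF k] am by (intro power_mono) (auto simp: xSuc mult_left_le_one_le)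
    then have "c1 * (norm (x (Suc k) - x k))\<^sup>2 \<le> c1 * (norm (d k))\<^sup>2"
      using c1 by simp
    \<comment> \<open>The decreasing tail never falls below its limit, so one decrease is at most
      the whole remaining distance.\<close>
    also have "\<dots> \<le> \<Phi> (x k) - \<phi>"
      using dec1[OF k] ge[of "Suc k - N"] k by (simp add: Suc_diff_le)
    finally show "c1 * (norm (x (Suc k) - x k))\<^sup>2 \<le> \<Phi> (x k) - \<phi>" .
  qed
qed

end
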